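(* Let $m,\tilde m\ge1$ be integers, $n$ an even positive integer and $q\ge1$ an integer. The configuration $\mathcal{A}^q_{(m,\tilde m,1^n)}=T_q(\mathcal{A}_{(m,\tilde m,1^n)})$ admits the Baker-Akhiezer function. The collection of lines of the corresponding arrangement forms the set of mirrors of the dihedral group $I_2(2q)$ (of order $4q$) together with $n/2$ $I_2(2q)$-orbits of lines where all the multiplicities are $1$.
   Context: A configuration is a finite set of pairwise non-collinear non-isotropic vectors $\alpha_i\in\mathbb{C}^2$ with multiplicities $m_i\in\mathbb{N}$; $(u,v)=u_1v_1+u_2v_2$. The corresponding arrangement consists of the lines $\Pi_i=\{x:(\alpha_i,x)=0\}$ taken with multiplicities $m_i$. Baker-Akhiezer (BA) function of a configuration: a function $\phi(\lambda,x)$, $\lambda,x\in\mathbb{C}^2$, such that (1) $\phi(\lambda,x)=P(\lambda,x)e^{(\lambda,x)}$ where $P$ is a polynomial in $\lambda$ and $x$ with highest term $\prod_{i}(\alpha_i,\lambda)^{m_i}(\alpha_i,x)^{m_i}$; (2) for all $i$ and all $1\le s\le m_i$, $\partial_{\alpha_i}^{2s-1}\phi(\lambda,x)|_{\Pi_i}=0$, where $\partial_{\alpha_i}=(\alpha_i,\frac{\partial}{\partial x})$. The configuration admits the BA function if such $\phi$ exists. The configuration $\mathcal{A}_{(m,\tilde m,1^n)}$ ($n$ even) consists of pairwise non-collinear vectors $\alpha_s=(\cos\varphi_s,\sin\varphi_s)\in\mathbb{R}^2$, $0\le s\le n+1$, with multiplicities $m_0=m$, $m_{n+1}=\tilde m$,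 $m_i=1$ for $1\le i\le n$, such that: $\alpha_0\perp\alpha_{n+1}$; the arrangement of lines (with multiplicities) is symmetric with respect to the reflection about $\alpha_0$; and, with $z_s=e^{2i\varphi_s}$, one has $\sum_{i=0,\,i\ne j}^{n+1}\frac{m_i(z_i+z_j)}{z_i-z_j}=0$ for all $j=1,\dots,n$. Such a configuration exists and is unique up to equivalence (orthogonal transformations and rescaling of the vectors). The operation $T_q$: for a configuration $\mathcal{A}$ of vectors $\alpha_i=(\cos\varphi_i,\sin\varphi_i)$ with multiplicities $m(\alpha_i)$, the configuration $T_q(\mathcal{A})$ consists of the vectors $\alpha_{i,s}=(\cos\varphi_{i,s},\sin\varphi_{i,s})$, $s=1,\dots,q$, where $\varphi_{i,s}=(\varphi_i+\pi s)/q$, with multiplicities $m(\alpha_{i,s})=m(\alpha_i)$. *)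

theory Defs
  imports "HOL-Analysis.Analysis" "HOL-Library.Poly_Mapping"
begin

definition bil :: "complex^2 \<Rightarrow> complex^2 \<Rightarrow> complex" where
  "bil u v = u $ 1 * v $ 1 + u $ 2 * v $ 2"

definition line :: "complex^2 \<Rightarrow> (complex^2) set" where
  "line \<alpha> = {x. bil \<alpha> x = 0}"

definition reflection :: "complex^2 \<Rightarrow> complex^2 \<Rightarrow> complex^2" where
  "reflection \<alpha> x = x - (2 * bil \<alpha> x / bil \<alpha> \<alpha>) *s \<alpha>"

definition rotation :: "real \<Rightarrow> complex^2 \<Rightarrow> complex^2" where
  "rotation t x = vector [of_real (cos t) * x $ 1 - of_real (sin t) * x $ 2,
                          of_real (sin t) * x $ 1 + of_real (cos t) * x $ 2]"

definition unit_vec :: "real \<Rightarrow> complex^2" where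
  "unit_vec t = vector [of_real (cos t), of_real (sin t)]"


section \<open>Configurations and arrangements\<close>

record 'i config =
  Idx :: "'i set"
  Vec :: "'i \<Rightarrow> complex^2"
  Mult :: "'i \<Rightarrow> nat"

definition configuration :: "'i config \<Rightarrow> bool" where
  "configuration C \<longleftrightarrow>
     finite (Idx C) \<and>
     (\<forall>i\<in>Idx C. bil (Vec C i) (Vec C i) \<noteq> 0 \<and> 0 < Mult C i) \<and>
     (\<forall>i\<in>Idx C. \<forall>j\<in>Idx C. i \<noteq> j \<longrightarrow> (\<nexists>c. Vec C i = c *s Vec C j))"

definition arrangement_lines :: "'i config \<Rightarrow> (complex^2) set set" where
  "arrangement_lines C = (\<lambda>i. line (Vec C i)) ` Idx C"

definition arrangement :: "'i config \<Rightarrow> ((complex^2) set \<times> nat) set" where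
  "arrangement C = (\<lambda>i. (line (Vec C i), Mult C i)) ` Idx C"

definition symmetric_under :: "'i config \<Rightarrow> (complex^2 \<Rightarrow> complex^2) \<Rightarrow> bool" where
  "symmetric_under C g \<longleftrightarrow> (\<lambda>(L, k). (g ` L, k)) ` arrangement C = arrangement C"


section \<open>The Baker-Akhiezer function\<close>

text \<open>Polynomials in \<open>(l, x)\<close>, with \<open>l\<close> the spectral variable \<open>\<lambda>\<close>: the first component of a key
  holds the exponents of \<open>l\<close>, the second one those of \<open>x\<close>. Degrees are total degrees in all four
  variables, and the highest term is the homogeneous component of top degree.\<close>

type_synonym poly_lx = "((nat^2) \<times> (nat^2)) \<Rightarrow>\<^sub>0 complex"

definition term_lx :: "poly_lx \<Rightarrow> complex^2 \<Rightarrow> complex^2 \<Rightarrow> (nat^2) \<times> (nat^2) \<Rightarrow> complex" where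
  "term_lx p l x e =
     Poly_Mapping.lookup p e * (\<Prod>i\<in>UNIV. l $ i ^ (fst e $ i)) * (\<Prod>i\<in>UNIV. x $ i ^ (snd e $ i))"

definition eval_lx :: "poly_lx \<Rightarrow> complex^2 \<Rightarrow> complex^2 \<Rightarrow> complex" where
  "eval_lx p l x = (\<Sum>e\<in>Poly_Mapping.keys p. term_lx p l x e)"

definition exponent_degree :: "(nat^2) \<times> (nat^2) \<Rightarrow> nat" where
  "exponent_degree e = (\<Sum>i\<in>UNIV. fst e $ i) + (\<Sum>i\<in>UNIV. snd e $ i)"

definition degree_lx :: "poly_lx \<Rightarrow> nat" where
  "degree_lx p = Max (exponent_degree ` Poly_Mapping.keys p)"

definition highest_term :: "poly_lx \<Rightarrow> complex^2 \<Rightarrow> complex^2 \<Rightarrow> complex" where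
  "highest_term p l x =
     (\<Sum>e\<in>{e \<in> Poly_Mapping.keys p. exponent_degree e = degree_lx p}. term_lx p l x e)"

definition dir_deriv ::
  "complex^2 \<Rightarrow> (complex^2 \<Rightarrow> complex) \<Rightarrow> complex^2 \<Rightarrow> complex" where
  "dir_deriv \<alpha> f x = deriv (\<lambda>t. f (x + t *s \<alpha>)) 0"

definition is_BA_function ::
  "'i config \<Rightarrow> (complex^2 \<Rightarrow> complex^2 \<Rightarrow> complex) \<Rightarrow> bool" where
  "is_BA_function C \<phi> \<longleftrightarrow>
     (\<exists>p. (\<forall>l x. \<phi> l x = eval_lx p l x * exp (bil l x)) \<and>
          (\<forall>l x. highest_term p l x =
             (\<Prod>i\<in>Idx C. bil (Vec C i) l ^ Mult C i * bil (Vec C i) x ^ Mult C i))) \<and>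
     (\<forall>i\<in>Idx C. \<forall>s\<in>{1..Mult C i}. \<forall>l. \<forall>x\<in>line (Vec C i).
        (dir_deriv (Vec C i) ^^ (2 * s - 1)) (\<phi> l) x = 0)"

definition admits_BA :: "'i config \<Rightarrow> bool" where
  "admits_BA C \<longleftrightarrow> (\<exists>\<phi>. is_BA_function C \<phi>)"


section \<open>Configurations given by angles\<close>

definition angle_config :: "'i set \<Rightarrow> ('i \<Rightarrow> real) \<Rightarrow> ('i \<Rightarrow> nat) \<Rightarrow> 'i config" where
  "angle_config I \<phi> \<mu> = \<lparr>Idx = I, Vec = (\<lambda>i. unit_vec (\<phi> i)), Mult = \<mu>\<rparr>"

text \<open>\<open>T_q\<close> acts on angles. Adding a multiple of \<open>\<pi>\<close> to some \<open>\<phi> i\<close> permutes the resulting vectors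
  up to sign.\<close>

definition T_config :: "nat \<Rightarrow> 'i set \<Rightarrow> ('i \<Rightarrow> real) \<Rightarrow> ('i \<Rightarrow> nat) \<Rightarrow> ('i \<times> nat) config" where
  "T_config q I \<phi> \<mu> =
     angle_config (I \<times> {1..q}) (\<lambda>(i, s). (\<phi> i + pi * real s) / real q) (\<lambda>(i, s). \<mu> i)"

definition A_mult :: "nat \<Rightarrow> nat \<Rightarrow> nat \<Rightarrow> nat \<Rightarrow> nat" where
  "A_mult m mt n i = (if i = 0 then m else if i = n + 1 then mt else 1)"

text \<open>\<open>is_A_angles m mt n \<phi>\<close>: the vectors with angles \<open>\<phi> 0, \<dots>, \<phi> (n + 1)\<close> form a configuration
  \<open>A_(m, mt, 1^n)\<close>, which is determined only up to equivalence. Since \<open>\<alpha>_0\<close> and \<open>\<alpha>_(n+1)\<close> are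
  orthogonal, the reflections in the line orthogonal to \<open>\<alpha>_0\<close> and in the line spanned by \<open>\<alpha>_0\<close>
  differ by \<open>-1\<close>, so they move lines in the same way.\<close>

definition is_A_angles :: "nat \<Rightarrow> nat \<Rightarrow> nat \<Rightarrow> (nat \<Rightarrow> real) \<Rightarrow> bool" where
  "is_A_angles m mt n \<phi> \<longleftrightarrow>
     (let C = angle_config {0..n+1} \<phi> (A_mult m mt n); z = (\<lambda>s. cis (2 * \<phi> s)) in
        configuration C \<and>
        bil (Vec C 0) (Vec C (n+1)) = 0 \<and>
        symmetric_under C (reflection (Vec C 0)) \<and>
        (\<forall>j\<in>{1..n}. (\<Sum>i\<in>{0..n+1} - {j}.
            of_nat (Mult C i) * (z i + z j) / (z i - z j)) = 0))"


section \<open>Dihedral groups\<close>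

text \<open>The dihedral group \<open>I_2(k)\<close> of order \<open>2k\<close>, acting on the complexified plane. The angle \<open>\<theta>\<close> is
  that of a normal to one of the mirrors, and fixes the position of the group inside \<open>O(2)\<close>.\<close>

definition dihedral :: "nat \<Rightarrow> real \<Rightarrow> (complex^2 \<Rightarrow> complex^2) set" where
  "dihedral k \<theta> =
     (\<lambda>j. rotation (2 * pi * real j / real k)) ` {..<k} \<union>
     (\<lambda>j. reflection (unit_vec (\<theta> + pi * real j / real k))) ` {..<k}"

definition mirrors :: "(complex^2 \<Rightarrow> complex^2) set \<Rightarrow> (complex^2) set set" where
  "mirrors G = {line \<alpha> | \<alpha>. bil \<alpha> \<alpha> \<noteq> 0 \<and> reflection \<alpha> \<in> G}"

definition line_orbit ::
  "(complex^2 \<Rightarrow> complex^2) set \<Rightarrow> (complex^2) set \<Rightarrow> (complex^2) set set" where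
  "line_orbit G L = (\<lambda>g. g ` L) ` G"

end

(* Put A = prod_i (alpha_i, x)^m_i and M = sum_i m_i. The gauged Calogero-Moser operator
     L = Laplacian - sum_i 2 m_i / (alpha_i, x) d_(alpha_i)
   maps quasi-invariant functions to quasi-invariant ones as soon as, for every line j and every odd
   r < 2 m_j, the sum over i ~= j of m_i cot(phi_i - phi_j)^r vanishes. Then, as in Berest's formula,
   (L - (l, l))^M applied to A^2 exp (l, x) is quasi-invariant; it is polynomial times exponential,
   and the part of top total degree is A (2 d_l)^M A = 2^M M! A(x) A(l).

   For T_q of the given configuration the condition holds on the lines coming from alpha_1, ...,
   alpha_n because sum_s cot((x + pi s) / q) = q cot x, and on those coming from alpha_0 and
   alpha_(n+1) because the arrangement is symmetric about them and the cotangent is odd.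

   The line at angle psi belongs to T_q iff q psi is congruent to some phi_i modulo pi, so that the
   dihedral orbits of lines correspond to the orbits of the reflection on the phi_i. *)

theory Submission
  imports Defs
begin

section \<open>Polynomial functions of the spectral and spatial variables\<close>

text \<open>The operator has poles along all the lines, and M applications of it must neither leave
  the polynomial functions nor lose sight of the part of top degree. Quasi-invariance of order one
  settles the first point: \<open>nabla (Vec C i) P\<close> vanishes on line i, so its linear form
  divides it. For the second, each iterate is kept as \<open>A * B + g\<close> with g of total
  degree below 2M. By the logarithmic derivative of A, the poles remove exactly the part 2 (d_l A) B
  produced by the conjugated Laplacian, so one step replaces B by 2 d_l B and alters only g
  otherwise. Halving at every step leaves M! as the only constant. Multiplicities above 1 are the
  delicate case, since a line of multiplicity m_j needs every odd power up to 2 m_j - 1 of the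
  cotangents to cancel. In the given family only \<alpha>_0 and \<alpha>_(n+1) can have such
  multiplicities, and the symmetry about them disposes of all odd powers at once.\<close>

lemma bil_commute: "bil u v = bil v u"
  by (simp add: bil_def mult.commute)

lemma bil_add_right: "bil u (v + w) = bil u v + bil u w"
  and bil_add_left: "bil (v + w) u = bil v u + bil w u"
  and bil_scale_right: "bil u (c *s v) = c * bil u v"
  and bil_scale_left: "bil (c *s v) u = c * bil v u"
  by (simp_all add: bil_def algebra_simps)

text \<open>The degree bound is an integer, so that differentiation and division by a linear form lower
  it by one without exception; a function of negative degree vanishes.\<close>

inductive poly_fun :: "int \<Rightarrow> (complex^2 \<Rightarrow> complex^2 \<Rightarrow> complex) \<Rightarrow> bool" where
  zero: "poly_fun d (\<lambda>l x. 0)"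
| const: "poly_fun 0 (\<lambda>l x. c)"
| spectral: "poly_fun 1 (\<lambda>l x. l $ i)"
| spatial: "poly_fun 1 (\<lambda>l x. x $ i)"
| add: "poly_fun d f \<Longrightarrow> poly_fun d g \<Longrightarrow> poly_fun d (\<lambda>l x. f l x + g l x)"
| mult: "poly_fun d f \<Longrightarrow> poly_fun e g \<Longrightarrow> poly_fun (d + e) (\<lambda>l x. f l x * g l x)"
| mono: "poly_fun d f \<Longrightarrow> d \<le> e \<Longrightarrow> poly_fun e f"

lemma poly_fun_mult_eq:
  "poly_fun d f \<Longrightarrow> poly_fun e g \<Longrightarrow> d + e = k \<Longrightarrow> poly_fun k (\<lambda>l x. f l x * g l x)"
  using poly_fun.mult by blast

lemma poly_fun_cmult: "poly_fun d f \<Longrightarrow> poly_fun d (\<lambda>l x. c * f l x)"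
  by (rule poly_fun_mult_eq[OF poly_fun.const]) auto

lemma poly_fun_diff:
  "poly_fun d f \<Longrightarrow> poly_fun d g \<Longrightarrow> poly_fun d (\<lambda>l x. f l x - g l x)"
  using poly_fun.add[OF _ poly_fun_cmult[of d g "-1"], of f] by simp

lemma poly_fun_bil_l: "poly_fun 1 (\<lambda>l x. bil a l)"
  and poly_fun_bil_x: "poly_fun 1 (\<lambda>l x. bil a x)"
  unfolding bil_def
  by (intro poly_fun.add poly_fun_cmult poly_fun.spectral poly_fun.spatial)+

lemma poly_fun_bil_ll: "poly_fun 2 (\<lambda>l x. bil l l)"
  unfolding bil_def
  by (intro poly_fun.add poly_fun_mult_eq[OF poly_fun.spectral poly_fun.spectral]) auto

lemma poly_fun_power: "poly_fun d f \<Longrightarrow> poly_fun (int k * d) (\<lambda>l x. f l x ^ k)"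
proof (induction k)
  case 0
  then show ?case using poly_fun.const[of 1] by simp
next
  case (Suc k)
  then show ?case
    using poly_fun_mult_eq[OF Suc.prems Suc.IH[OF Suc.prems]] by (simp add: algebra_simps)
qed

lemma poly_fun_sum:
  "(\<And>i. i \<in> I \<Longrightarrow> poly_fun d (f i)) \<Longrightarrow> poly_fun d (\<lambda>l x. \<Sum>i\<in>I. f i l x)"
  by (induction I rule: infinite_finite_induct) (auto intro: poly_fun.zero poly_fun.add)

lemma poly_fun_prod:
  "(\<And>i. i \<in> I \<Longrightarrow> poly_fun (d i) (f i)) \<Longrightarrow> poly_fun (\<Sum>i\<in>I. d i) (\<lambda>l x. \<Prod>i\<in>I. f i l x)"
  by (induction I rule: infinite_finite_induct) (auto intro: poly_fun.const poly_fun.mult)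

lemma poly_fun_continuous: "poly_fun d f \<Longrightarrow> continuous_on UNIV (f l)"
  by (induction rule: poly_fun.induct) (auto intro!: continuous_intros)

definition x_deriv :: "complex^2 \<Rightarrow> (complex^2 \<Rightarrow> complex^2 \<Rightarrow> complex) \<Rightarrow> complex^2 \<Rightarrow> complex^2 \<Rightarrow> complex"
  where "x_deriv v f l x = dir_deriv v (f l) x"

lemma dir_derivI:
  "((\<lambda>t. f (x + t *s v)) has_field_derivative D) (at 0) \<Longrightarrow> dir_deriv v f x = D"
  unfolding dir_deriv_def by (rule DERIV_imp_deriv)

text \<open>Existence of the derivative and its degree bound go through one induction, since the
  product rule needs both for the factors. A constant has derivative 0 with bound -1, which integer
  bounds admit.\<close>

lemma poly_fun_deriv_ex:
  assumes "poly_fun d f"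
  shows "\<exists>g. poly_fun (d - 1) g \<and>
    (\<forall>l x. ((\<lambda>t. f l (x + t *s v)) has_field_derivative g l x) (at 0))"
  using assms
proof (induction rule: poly_fun.induct)
  case (spectral i)
  show ?case by (intro exI[of _ "\<lambda>l x. 0"]) (auto intro: poly_fun.zero)
next
  case (spatial i)
  show ?case
    by (intro exI[of _ "\<lambda>l x. v $ i"])
       (auto intro!: derivative_eq_intros poly_fun.const)
next
  case (add d f g)
  then obtain f' g' where "poly_fun (d - 1) f'" "poly_fun (d - 1) g'"
    "\<And>l x. ((\<lambda>t. f l (x + t *s v)) has_field_derivative f' l x) (at 0)"
    "\<And>l x. ((\<lambda>t. g l (x + t *s v)) has_field_derivative g' l x) (at 0)" by blast
  then show ?case
    by (intro exI[of _ "\<lambda>l x. f' l x + g' l x"]) (auto intro: poly_fun.add DERIV_add)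
next
  case (mult d f e g)
  then obtain f' g' where 1: "poly_fun (d - 1) f'" "poly_fun (e - 1) g'"
    "\<And>l x. ((\<lambda>t. f l (x + t *s v)) has_field_derivative f' l x) (at 0)"
    "\<And>l x. ((\<lambda>t. g l (x + t *s v)) has_field_derivative g' l x) (at 0)" by blast
  have "poly_fun (d + e - 1) (\<lambda>l x. f' l x * g l x + f l x * g' l x)"
    by (intro poly_fun.add poly_fun_mult_eq[OF 1(1) mult.hyps(2)]
          poly_fun_mult_eq[OF mult.hyps(1) 1(2)]) auto
  moreover have "((\<lambda>t. f l (x + t *s v) * g l (x + t *s v)) has_field_derivative
      f' l x * g l x + f l x * g' l x) (at 0)" for l x
    using DERIV_mult[OF 1(3)[of l x] 1(4)[of l x]] by (simp add: algebra_simps)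
  ultimately show ?case by blast
next
  case (mono d f e)
  then show ?case by (meson diff_right_mono poly_fun.mono)
qed (auto intro: poly_fun.zero exI[of _ "\<lambda>l x. 0"])

lemma poly_fun_x_deriv: "poly_fun d f \<Longrightarrow> poly_fun (d - 1) (x_deriv v f)"
  and poly_fun_has_x_deriv: "poly_fun d f \<Longrightarrow>
    ((\<lambda>t. f l (x + t *s v)) has_field_derivative x_deriv v f l x) (at 0)"
proof -
  assume "poly_fun d f"
  then obtain g where g: "poly_fun (d - 1) g"
    "\<And>l x. ((\<lambda>t. f l (x + t *s v)) has_field_derivative g l x) (at 0)"
    using poly_fun_deriv_ex by blast
  have "x_deriv v f = g"
    by (intro ext) (simp add: x_deriv_def dir_derivI[OF g(2)])
  with g show "poly_fun (d - 1) (x_deriv v f)"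
    "((\<lambda>t. f l (x + t *s v)) has_field_derivative x_deriv v f l x) (at 0)" by auto
qed

lemma x_deriv_eqI:
  "(\<And>l x. ((\<lambda>t. f l (x + t *s v)) has_field_derivative D l x) (at 0)) \<Longrightarrow> x_deriv v f = D"
  by (intro ext) (simp add: x_deriv_def dir_derivI)

lemma x_deriv_l: "x_deriv v (\<lambda>l x. h l) = (\<lambda>l x. 0)"
  by (rule x_deriv_eqI) auto

lemma x_deriv_spatial: "x_deriv v (\<lambda>l x. x $ i) = (\<lambda>l x. v $ i)"
  by (rule x_deriv_eqI) (auto intro!: derivative_eq_intros)

lemma x_deriv_bil: "x_deriv v (\<lambda>l x. bil a x) = (\<lambda>l x. bil a v)"
  by (rule x_deriv_eqI) (auto intro!: derivative_eq_intros simp: bil_def)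

lemma x_deriv_add:
  "poly_fun d f \<Longrightarrow> poly_fun e g \<Longrightarrow>
    x_deriv v (\<lambda>l x. f l x + g l x) = (\<lambda>l x. x_deriv v f l x + x_deriv v g l x)"
  by (rule x_deriv_eqI) (intro DERIV_add poly_fun_has_x_deriv)

lemma x_deriv_mult:
  "poly_fun d f \<Longrightarrow> poly_fun e g \<Longrightarrow>
    x_deriv v (\<lambda>l x. f l x * g l x) = (\<lambda>l x. x_deriv v f l x * g l x + f l x * x_deriv v g l x)"
  by (rule x_deriv_eqI, drule (1) DERIV_mult[OF poly_fun_has_x_deriv poly_fun_has_x_deriv])
     (simp add: algebra_simps)

lemma x_deriv_scale:
  "poly_fun d f \<Longrightarrow> x_deriv v (\<lambda>l x. h l * f l x) = (\<lambda>l x. h l * x_deriv v f l x)"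
  by (rule x_deriv_eqI) (intro DERIV_cmult poly_fun_has_x_deriv)

text \<open>Induction on the polynomial takes the place of the chain rule: linearity in the
  direction holds for coordinates and is inherited by sums and products.\<close>

lemma x_deriv_linear:
  assumes "poly_fun d f"
  shows "x_deriv (a *s v + b *s w) f l x = a * x_deriv v f l x + b * x_deriv w f l x"
  using assms
proof (induction arbitrary: l x rule: poly_fun.induct)
  case (add d f g)
  then show ?case by (simp add: x_deriv_add algebra_simps)
next
  case (mult d f e g)
  then show ?case by (simp add: x_deriv_mult algebra_simps)
qed (simp_all add: x_deriv_l x_deriv_spatial)

lemma x_deriv_commute:
  assumes "poly_fun d f"
  shows "x_deriv v (x_deriv w f) = x_deriv w (x_deriv v f)"
  using assms
proof (induction rule: poly_fun.induct)
  case (add d f g)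
  note p = poly_fun_x_deriv[OF add.hyps(1)] poly_fun_x_deriv[OF add.hyps(2)]
  show ?case
    by (simp add: x_deriv_add[OF add.hyps] x_deriv_add[OF p] add.IH)
next
  case (mult d f e g)
  note p = poly_fun_x_deriv[OF mult.hyps(1)] poly_fun_x_deriv[OF mult.hyps(2)]
  have "poly_fun (d + e - 1) (\<lambda>l x. x_deriv v f l x * g l x)"
       "poly_fun (d + e - 1) (\<lambda>l x. f l x * x_deriv v g l x)" for v
    by (rule poly_fun_mult_eq[OF p(1) mult.hyps(2)], simp,
        rule poly_fun_mult_eq[OF mult.hyps(1) p(2)], simp)
  note x_deriv_add[OF this]
  then show ?case
    by (simp add: x_deriv_mult[OF mult.hyps] x_deriv_mult[OF p(1) mult.hyps(2)]
        x_deriv_mult[OF mult.hyps(1) p(2)] mult.IH add_ac)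
qed (simp_all add: x_deriv_l x_deriv_spatial)

section \<open>Exact division by a linear form\<close>

lemma poly_fun_subst_sub:
  assumes "poly_fun d f"
  shows "poly_fun d (\<lambda>l x. f l (x - bil a x *s b))"
  using assms
proof (induction rule: poly_fun.induct)
  case (spatial i)
  show ?case
    by (simp, intro poly_fun_diff poly_fun.spatial poly_fun_mult_eq[OF poly_fun_bil_x poly_fun.const])
       simp
qed (simp_all add: poly_fun.zero poly_fun.const poly_fun.spectral poly_fun.add poly_fun.mult poly_fun.mono)

text \<open>The shift along \<open>b\<close> changes each coordinate by a multiple of
  \<open>bil a x\<close>, and the discrete product rule f g - f' g' = (f - f') g + f' (g - g')
  passes this on to products.\<close>

lemma poly_fun_subst_divisible:
  assumes "poly_fun d f"
  shows "\<exists>g. poly_fun (d - 1) g \<and> (\<forall>l x. f l x - f l (x - bil a x *s b) = bil a x * g l x)"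
  using assms
proof (induction rule: poly_fun.induct)
  case (spatial i)
  show ?case by (intro exI[of _ "\<lambda>l x. b $ i"]) (auto intro: poly_fun.const)
next
  case (add d f g)
  then obtain f' g' where "poly_fun (d - 1) f'" "poly_fun (d - 1) g'"
    "\<And>l x. f l x - f l (x - bil a x *s b) = bil a x * f' l x"
    "\<And>l x. g l x - g l (x - bil a x *s b) = bil a x * g' l x" by blast
  then show ?case
    by (intro exI[of _ "\<lambda>l x. f' l x + g' l x"])
       (auto intro!: poly_fun.add simp: distrib_left add_diff_add)
next
  case (mult d f e g)
  let ?s = "\<lambda>x. x - bil a x *s b"
  from mult obtain f' g' where 1: "poly_fun (d - 1) f'" "poly_fun (e - 1) g'"
    "\<And>l x. f l x - f l (?s x) = bil a x * f' l x"
    "\<And>l x. g l x - g l (?s x) = bil a x * g' l x" by blast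
  have "poly_fun (d + e - 1) (\<lambda>l x. f' l x * g l x + f l (?s x) * g' l x)"
    by (intro poly_fun.add poly_fun_mult_eq[OF 1(1) mult.hyps(2)]
          poly_fun_mult_eq[OF poly_fun_subst_sub[OF mult.hyps(1)] 1(2)]) auto
  moreover have "f l x * g l x - f l (?s x) * g l (?s x)
      = bil a x * (f' l x * g l x + f l (?s x) * g' l x)" for l x
  proof -
    have "f l x * g l x - f l (?s x) * g l (?s x)
        = (f l x - f l (?s x)) * g l x + f l (?s x) * (g l x - g l (?s x))"
      by (simp only: algebra_simps)
    then show ?thesis unfolding 1 by (simp add: algebra_simps)
  qed
  ultimately show ?case by blast
next
  case (mono d f e)
  then show ?case by (meson diff_right_mono poly_fun.mono)
qed (auto intro: poly_fun.zero exI[of _ "\<lambda>l x. 0"])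

text \<open>With \<open>b\<close> equal to \<open>a\<close> divided by \<open>bil a a\<close>, the
  shifted point is the orthogonal projection to the line of \<open>a\<close>, where \<open>f\<close>
  vanishes; the difference is then \<open>f\<close> itself.\<close>

lemma poly_fun_divide_linear:
  assumes "poly_fun d f" and "bil a a \<noteq> 0" and "\<And>l x. bil a x = 0 \<Longrightarrow> f l x = 0"
  shows "\<exists>g. poly_fun (d - 1) g \<and> (\<forall>l x. f l x = bil a x * g l x)"
proof -
  obtain g where g: "poly_fun (d - 1) g"
    "\<And>l x. f l x - f l (x - bil a x *s ((1 / bil a a) *s a)) = bil a x * g l x"
    using poly_fun_subst_divisible[OF assms(1)] by blast
  have "bil a (x - bil a x *s ((1 / bil a a) *s a)) = 0" for x
    using assms(2) by (simp add: bil_def field_simps)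
  with g(2) have "f l x = bil a x * g l x" for l x
    using assms(3) by simp
  with g(1) show ?thesis by blast
qed


section \<open>The conjugated derivative and its Taylor series\<close>

text \<open>\<open>nabla v\<close> is the derivative along \<open>v\<close> conjugated by \<open>exp (bil l x)\<close>; this keeps the
  whole argument inside polynomial functions.\<close>

definition nabla :: "complex^2 \<Rightarrow> (complex^2 \<Rightarrow> complex^2 \<Rightarrow> complex) \<Rightarrow> complex^2 \<Rightarrow> complex^2 \<Rightarrow> complex"
  where "nabla v f = (\<lambda>l x. x_deriv v f l x + bil v l * f l x)"

lemma poly_fun_nabla: "poly_fun d f \<Longrightarrow> poly_fun (d + 1) (nabla v f)"
  unfolding nabla_def
  by (intro poly_fun.add poly_fun.mono[OF poly_fun_x_deriv]
        poly_fun_mult_eq[OF poly_fun_bil_l]) auto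

lemma poly_fun_nabla_power: "poly_fun d f \<Longrightarrow> poly_fun (d + int k) ((nabla v ^^ k) f)"
proof (induction k)
  case (Suc k)
  then show ?case using poly_fun_nabla[OF Suc.IH[OF Suc.prems]] by (simp add: add_ac)
qed simp

lemma nabla_add:
  "poly_fun d f \<Longrightarrow> poly_fun e g \<Longrightarrow>
    nabla v (\<lambda>l x. f l x + g l x) = (\<lambda>l x. nabla v f l x + nabla v g l x)"
  by (simp add: nabla_def x_deriv_add algebra_simps)

lemma nabla_scale:
  "poly_fun d f \<Longrightarrow> nabla v (\<lambda>l x. h l * f l x) = (\<lambda>l x. h l * nabla v f l x)"
  by (simp add: nabla_def x_deriv_scale algebra_simps)

lemma nabla_bil_mult:
  assumes "poly_fun d f"
  shows "nabla v (\<lambda>l x. bil a x * f l x) = (\<lambda>l x. bil a v * f l x + bil a x * nabla v f l x)"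
  by (simp add: nabla_def x_deriv_mult[OF poly_fun_bil_x assms] x_deriv_bil algebra_simps)

lemma nabla_linear:
  "poly_fun d f \<Longrightarrow> nabla (a *s v + b *s w) f = (\<lambda>l x. a * nabla v f l x + b * nabla w f l x)"
  by (intro ext) (simp add: nabla_def x_deriv_linear bil_add_left bil_scale_left algebra_simps)

lemma nabla_nabla:
  assumes "poly_fun d f"
  shows "nabla v (nabla w f) l x =
    x_deriv v (x_deriv w f) l x + bil w l * x_deriv v f l x + bil v l * x_deriv w f l x + bil v l * bil w l * f l x"
proof -
  have "poly_fun (d + 1) (\<lambda>l x. bil w l * f l x)"
    by (intro poly_fun_mult_eq[OF poly_fun_bil_l assms]) simp
  note x_deriv_add[OF poly_fun_x_deriv[OF assms] this]
  then show ?thesis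
    by (simp add: nabla_def x_deriv_scale[OF assms] algebra_simps)
qed

lemma nabla_commute: "poly_fun d f \<Longrightarrow> nabla v (nabla w f) = nabla w (nabla v f)"
  by (intro ext) (simp add: nabla_nabla x_deriv_commute[of d f v w])

lemma nabla_power_commute:
  assumes "poly_fun d f"
  shows "(nabla v ^^ k) (nabla w f) = nabla w ((nabla v ^^ k) f)"
proof (induction k)
  case (Suc k)
  then show ?case using nabla_commute[OF poly_fun_nabla_power[OF assms]] by simp
qed simp

text \<open>The Taylor series at \<open>t = 0\<close> of \<open>f l (x + t v) exp (bil l (x + t v))\<close>, up to the
  factor \<open>exp (bil l x)\<close>.\<close>

definition taylor :: "complex^2 \<Rightarrow> complex^2 \<Rightarrow> complex^2 \<Rightarrow> (complex^2 \<Rightarrow> complex^2 \<Rightarrow> complex) \<Rightarrow> complex fps"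
  where "taylor v l x f = Abs_fps (\<lambda>k. (nabla v ^^ k) f l x / fact k)"

lemma taylor_nth: "fps_nth (taylor v l x f) k = (nabla v ^^ k) f l x / fact k"
  by (simp add: taylor_def)

lemma taylor_nabla: "taylor v l x (nabla v f) = fps_deriv (taylor v l x f)"
  by (rule fps_ext) (simp add: taylor_nth funpow_swap1 field_simps del: of_nat_Suc)

lemma nabla_power_add:
  assumes "poly_fun d f" "poly_fun e g"
  shows "(nabla v ^^ k) (\<lambda>l x. f l x + g l x) = (\<lambda>l x. (nabla v ^^ k) f l x + (nabla v ^^ k) g l x)"
proof (induction k)
  case (Suc k)
  then show ?case
    using nabla_add[OF poly_fun_nabla_power[OF assms(1)] poly_fun_nabla_power[OF assms(2)]] by simp
qed simp

lemma nabla_power_scale: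
  assumes "poly_fun d f"
  shows "(nabla v ^^ k) (\<lambda>l x. h l * f l x) = (\<lambda>l x. h l * (nabla v ^^ k) f l x)"
proof (induction k)
  case (Suc k)
  then show ?case
    using nabla_scale[OF poly_fun_nabla_power[OF assms]] by simp
qed simp

lemma taylor_add:
  "poly_fun d f \<Longrightarrow> poly_fun e g \<Longrightarrow>
    taylor v l x (\<lambda>l x. f l x + g l x) = taylor v l x f + taylor v l x g"
  by (rule fps_ext) (simp add: taylor_nth nabla_power_add add_divide_distrib)

lemma taylor_scale:
  "poly_fun d f \<Longrightarrow> taylor v l x (\<lambda>l x. h l * f l x) = fps_const (h l) * taylor v l x f"
  by (rule fps_ext) (simp add: taylor_nth nabla_power_scale)

lemma taylor_cmult:
  "poly_fun d f \<Longrightarrow> taylor v l x (\<lambda>l x. c * f l x) = fps_const c * taylor v l x f"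
  by (rule taylor_scale)

lemma taylor_zero: "taylor v l x (\<lambda>l x. 0) = 0"
  using taylor_scale[OF poly_fun.zero[of 0], of v l x "\<lambda>_. 0"] by simp

lemma taylor_sum:
  "(\<And>i. i \<in> I \<Longrightarrow> poly_fun d (f i)) \<Longrightarrow>
    taylor v l x (\<lambda>l x. \<Sum>i\<in>I. f i l x) = (\<Sum>i\<in>I. taylor v l x (f i))"
proof (induction I rule: infinite_finite_induct)
  case (insert i I)
  then show ?case
    using taylor_add[of d "f i" d "\<lambda>l x. \<Sum>i\<in>I. f i l x"] poly_fun_sum[of I d f] by simp
qed (auto simp: taylor_zero)

text \<open>The Leibniz sum has only two terms, because a linear form has no second
  derivative.\<close>

lemma nabla_power_bil_mult:
  assumes "poly_fun d f"
  shows "(nabla v ^^ Suc k) (\<lambda>l x. bil a x * f l x) =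
    (\<lambda>l x. of_nat (Suc k) * bil a v * (nabla v ^^ k) f l x + bil a x * (nabla v ^^ Suc k) f l x)"
proof (induction k)
  case 0
  then show ?case by (simp add: nabla_bil_mult[OF assms])
next
  case (Suc k)
  let ?g = "(nabla v ^^ k) f" and ?h = "(nabla v ^^ Suc k) f"
  have g: "poly_fun (d + int k) ?g" and h: "poly_fun (d + int (Suc k)) ?h"
    using poly_fun_nabla_power[OF assms] by blast+
  have "nabla v (\<lambda>l x. of_nat (Suc k) * bil a v * ?g l x + bil a x * ?h l x) =
    (\<lambda>l x. nabla v (\<lambda>l x. of_nat (Suc k) * bil a v * ?g l x) l x + nabla v (\<lambda>l x. bil a x * ?h l x) l x)"
    by (rule nabla_add[OF poly_fun_cmult[OF g] poly_fun.mult[OF poly_fun_bil_x h]])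
  also have "\<dots> = (\<lambda>l x. of_nat (Suc (Suc k)) * bil a v * ?h l x + bil a x * (nabla v ^^ Suc (Suc k)) f l x)"
    by (simp only: nabla_bil_mult[OF h] nabla_scale[OF g, of v "\<lambda>_. c" for c])
       (simp add: algebra_simps)
  finally show ?case using Suc by simp
qed

text \<open>The factor is the restriction of the linear form to a line:
  \<open>bil a (x + t *s v) = bil a x + t * bil a v\<close>.\<close>

lemma taylor_bil_mult:
  assumes "poly_fun d f"
  shows "taylor v l x (\<lambda>l x. bil a x * f l x) =
    (fps_const (bil a x) + fps_const (bil a v) * fps_X) * taylor v l x f"
proof (rule fps_ext)
  fix k
  show "fps_nth (taylor v l x (\<lambda>l x. bil a x * f l x)) k =
    fps_nth ((fps_const (bil a x) + fps_const (bil a v) * fps_X) * taylor v l x f) k"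
  proof (cases k)
    case 0
    then show ?thesis by (simp add: taylor_nth)
  next
    case (Suc j)
    have "(nabla v ^^ Suc j) (\<lambda>l x. bil a x * f l x) l x / fact (Suc j)
      = of_nat (Suc j) * bil a v * (nabla v ^^ j) f l x / fact (Suc j)
        + bil a x * (nabla v ^^ Suc j) f l x / fact (Suc j)"
      unfolding nabla_power_bil_mult[OF assms] add_divide_distrib by simp
    also have "of_nat (Suc j) * bil a v * (nabla v ^^ j) f l x / fact (Suc j) =
         bil a v * ((nabla v ^^ j) f l x / fact j)"
      by (simp add: field_simps del: of_nat_Suc)
    finally show ?thesis
      unfolding Suc taylor_nth
      by (simp add: distrib_right mult.assoc taylor_nth del: funpow.simps)
  qed
qed

text \<open>Condition (2) on a Baker-Akhiezer function with the exponential taken out; the odd k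
  below \<open>2 * Mult C i\<close> are the orders 2s - 1 with 1 \<le> s \<le>
  \<open>Mult C i\<close>.\<close>

definition quasi_inv :: "'i config \<Rightarrow> (complex^2 \<Rightarrow> complex^2 \<Rightarrow> complex) \<Rightarrow> bool"
  where "quasi_inv C f \<longleftrightarrow> (\<forall>i\<in>Idx C. \<forall>k. odd k \<longrightarrow> k < 2 * Mult C i \<longrightarrow>
    (\<forall>l. \<forall>x\<in>line (Vec C i). (nabla (Vec C i) ^^ k) f l x = 0))"

lemma taylor_power_mult:
  assumes "poly_fun d f"
  shows "taylor v l x (\<lambda>l x. bil a x ^ N * f l x) =
    (fps_const (bil a x) + fps_const (bil a v) * fps_X) ^ N * taylor v l x f"
proof (induction N)
  case (Suc N)
  have "poly_fun (int N * 1 + d) (\<lambda>l x. bil a x ^ N * f l x)"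
    by (intro poly_fun.mult poly_fun_power poly_fun_bil_x assms)
  from taylor_bil_mult[OF this] show ?case
    by (simp add: mult.assoc Suc)
qed simp

text \<open>Where \<open>bil a x\<close> is zero, the Taylor series of the power is a constant times
  \<open>fps_X ^ N\<close>.\<close>

lemma nabla_power_vanish:
  assumes "poly_fun d f" "bil a x = 0" "k < N"
  shows "(nabla v ^^ k) (\<lambda>l x. bil a x ^ N * f l x) l x = 0"
proof -
  have "fps_nth (taylor v l x (\<lambda>l x. bil a x ^ N * f l x)) k = 0"
    unfolding taylor_power_mult[OF assms(1)] assms(2)
    using assms(3)
    by (simp add: power_mult_distrib mult.assoc fps_const_power fps_X_power_mult_nth)
  then show ?thesis by (simp add: taylor_nth)
qed

section \<open>Directions along and across a line\<close>

definition perp :: "complex^2 \<Rightarrow> complex^2"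
  where "perp v = vector [- v $ 2, v $ 1]"

lemma perp_nth [simp]: "perp v $ 1 = - v $ 2" "perp v $ 2 = v $ 1"
  by (simp_all add: perp_def)

lemma bil_perp [simp]: "bil (perp v) (perp w) = bil v w" "bil v (perp v) = 0" "bil (perp v) v = 0"
  by (simp_all add: bil_def)

lemma line_perp:
  assumes "bil v v \<noteq> 0"
  shows "line v = range (\<lambda>s. s *s perp v)"
proof (intro equalityI subsetI)
  fix x assume x: "x \<in> line v"
  have "x = (bil (perp v) x / bil v v) *s perp v"
    using x assms unfolding vec_eq_iff forall_2 line_def mem_Collect_eq
    unfolding bil_def by (simp add: field_simps) algebra
  then show "x \<in> range (\<lambda>s. s *s perp v)" by blast
qed (auto simp: line_def bil_scale_right)

lemma perp_decomp:
  assumes "bil v v \<noteq> 0"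
  shows "w = (bil w v / bil v v) *s v + (bil w (perp v) / bil v v) *s perp v"
proof -
  have "bil v v * w $ 1 = bil w v * v $ 1 + bil w (perp v) * perp v $ 1"
    "bil v v * w $ 2 = bil w v * v $ 2 + bil w (perp v) * perp v $ 2"
    by (simp_all add: bil_def algebra_simps)
  with assms show ?thesis
    unfolding vec_eq_iff forall_2 by (simp add: field_simps)
qed

text \<open>A function that vanishes on the whole line has zero derivative along it, and the
  additional term of \<open>nabla\<close> is a multiple of its value. Commutation of the conjugated
  derivatives reduces the claim to this.\<close>

lemma nabla_power_tangential:
  assumes "poly_fun d f" "bil v v \<noteq> 0" "\<And>x. x \<in> line v \<Longrightarrow> (nabla v ^^ k) f l x = 0" "x \<in> line v"
  shows "(nabla v ^^ k) (nabla (perp v) f) l x = 0"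
proof -
  let ?g = "(nabla v ^^ k) f"
  have "?g l (x + t *s perp v) = 0" for t
    using assms(3,4) by (simp add: line_def bil_add_right bil_scale_right)
  then have "x_deriv (perp v) ?g l x = 0"
    unfolding x_deriv_def by (intro dir_derivI) simp
  then show ?thesis
    using assms(3,4) by (simp add: nabla_power_commute[OF assms(1)]) (simp add: nabla_def)
qed


section \<open>Invariance of quasi-invariants under the Calogero-Moser operator\<close>

definition even_below :: "nat \<Rightarrow> complex fps \<Rightarrow> bool"
  where "even_below N F \<longleftrightarrow> (\<forall>k<N. odd k \<longrightarrow> fps_nth F k = 0)"

definition odd_below :: "nat \<Rightarrow> complex fps \<Rightarrow> bool"
  where "odd_below N F \<longleftrightarrow> (\<forall>k<N. even k \<longrightarrow> fps_nth F k = 0)"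

lemma even_below_mult: "even_below N F \<Longrightarrow> even_below N G \<Longrightarrow> even_below N (F * G)"
  unfolding even_below_def fps_mult_nth
proof (intro allI impI sum.neutral ballI)
  fix k i assume *: "\<forall>k<N. odd k \<longrightarrow> fps_nth F k = 0" "\<forall>k<N. odd k \<longrightarrow> fps_nth G k = 0"
    and k: "k < N" "odd k" and i: "i \<in> {0..k}"
  show "fps_nth F i * fps_nth G (k - i) = 0"
    using * k i by (cases "odd i") auto
qed

text \<open>In a coefficient of odd order k exactly one of the two indices is even, and it is at
  most k - 1. Hence vanishing below N - 1 suffices, which makes up for the order lost in
  \<open>odd_below_deriv\<close>.\<close>

lemma odd_below_mult:
  assumes "odd_below (N - 1) F" "odd_below (N - 1) G"
  shows "even_below N (F * G)"
  unfolding even_below_def fps_mult_nth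
proof (intro allI impI sum.neutral ballI)
  fix k i assume k: "k < N" "odd k" and i: "i \<in> {0..k}"
  show "fps_nth F i * fps_nth G (k - i) = 0"
  proof (cases "even i")
    case True
    with k i have "i < N - 1" by (cases "i = k") auto
    with True assms show ?thesis by (simp add: odd_below_def)
  next
    case False
    with k i have "even (k - i)" "k - i < N - 1" by (auto elim: oddE)
    with assms show ?thesis by (simp add: odd_below_def)
  qed
qed

lemma odd_below_deriv: "even_below N F \<Longrightarrow> odd_below (N - 1) (fps_deriv F)"
  by (auto simp: even_below_def odd_below_def)

text \<open>With \<open>\<alpha>\<^sub>j\<close> and its perpendicular as axes, these are the odd coefficients of the
  expansions at the line \<open>j\<close> of the first order part of the operator that comes from the other
  lines.\<close>

definition locus :: "'i config \<Rightarrow> bool"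
  where "locus C \<longleftrightarrow> (\<forall>j\<in>Idx C. \<forall>r. odd r \<longrightarrow> r < 2 * Mult C j \<longrightarrow>
    (\<Sum>i\<in>Idx C - {j}. of_nat (Mult C i) *
       (bil (Vec C i) (Vec C j) / bil (Vec C i) (perp (Vec C j))) ^ r) = 0)"

definition nabla_sq :: "(complex^2 \<Rightarrow> complex^2 \<Rightarrow> complex) \<Rightarrow> complex^2 \<Rightarrow> complex^2 \<Rightarrow> complex"
  where "nabla_sq f = (\<lambda>l x. nabla (axis 1 1) (nabla (axis 1 1) f) l x + nabla (axis 2 1) (nabla (axis 2 1) f) l x)"

lemma axis_decomp: "v = v $ 1 *s axis 1 1 + v $ 2 *s axis 2 (1::complex)" for v :: "complex^2"
  unfolding vec_eq_iff forall_2 by (simp add: axis_def)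

lemma nabla_axis:
  "poly_fun d f \<Longrightarrow> nabla v f = (\<lambda>l x. v $ 1 * nabla (axis 1 1) f l x + v $ 2 * nabla (axis 2 1) f l x)"
  by (rule trans[OF arg_cong[OF axis_decomp, of "\<lambda>w. nabla w f"] nabla_linear])

text \<open>The Laplacian in the frame \<open>v\<close>, \<open>perp v\<close>: the mixed terms
  cancel by orthogonality, and the factor \<open>bil v v\<close> appears because the frame is not
  normalised.\<close>

lemma nabla_sq_perp:
  assumes "poly_fun d f"
  shows "bil v v * nabla_sq f l x = nabla v (nabla v f) l x + nabla (perp v) (nabla (perp v) f) l x"
proof -
  note p = poly_fun_nabla[OF assms]
  have *: "nabla w (nabla w f) l x = w $ 1 * (w $ 1 * nabla (axis 1 1) (nabla (axis 1 1) f) l x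
      + w $ 2 * nabla (axis 1 1) (nabla (axis 2 1) f) l x)
     + w $ 2 * (w $ 1 * nabla (axis 1 1) (nabla (axis 2 1) f) l x
      + w $ 2 * nabla (axis 2 1) (nabla (axis 2 1) f) l x)" for w
  proof -
    have 1: "nabla u (nabla w f) l x = w $ 1 * nabla (axis 1 1) (nabla u f) l x + w $ 2 * nabla (axis 2 1) (nabla u f) l x"
      for u
      unfolding nabla_commute[OF assms, of u w] by (rule nabla_axis[OF p, THEN fun_cong, THEN fun_cong])
    have 2: "nabla w (nabla w f) l x = w $ 1 * nabla (axis 1 1) (nabla w f) l x + w $ 2 * nabla (axis 2 1) (nabla w f) l x"
      by (rule nabla_axis[OF p, THEN fun_cong, THEN fun_cong])
    show ?thesis
      unfolding 2 1[of "axis 1 1"] 1[of "axis 2 1"] nabla_commute[OF assms, of "axis 2 1" "axis 1 1"] ..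
  qed
  show ?thesis
    unfolding nabla_sq_def *[of v] *[of "perp v"] by (simp add: bil_def algebra_simps)
qed

lemma poly_fun_nabla_sq:
  assumes "poly_fun d f"
  shows "poly_fun (d + 2) (nabla_sq f)"
proof -
  have "poly_fun (d + 2) (nabla v (nabla v f))" for v
    using poly_fun_nabla[OF poly_fun_nabla[OF assms], of v v] by (simp add: add.assoc)
  then show ?thesis
    unfolding nabla_sq_def by (intro poly_fun.add)
qed

lemma taylor_nabla_sq:
  assumes "poly_fun d f" "bil v v \<noteq> 0"
  shows "taylor v l x (nabla_sq f) = fps_const (1 / bil v v) *
    (fps_deriv (fps_deriv (taylor v l x f)) + taylor v l x (nabla (perp v) (nabla (perp v) f)))"
proof -
  note p = poly_fun_nabla[OF poly_fun_nabla[OF assms(1)]]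
  have 1: "nabla_sq f = (\<lambda>l x. (1 / bil v v) * (nabla v (nabla v f) l x + nabla (perp v) (nabla (perp v) f) l x))"
    by (intro ext) (simp add: nabla_sq_perp[OF assms(1), symmetric] assms(2))
  show ?thesis
    unfolding 1 taylor_cmult[OF poly_fun.add[OF p p]] taylor_add[OF p p] taylor_nabla ..
qed

text \<open>At \<open>s *s perp v + t *s v\<close> the linear form of \<open>a\<close> equals s
  \<open>bil a (perp v)\<close> (1 + c t / s), and its inverse is a geometric series of ratio -c /
  s. The last factor comes from splitting the direction \<open>a\<close> along \<open>v\<close> and
  \<open>perp v\<close>. For unit vectors c is the cotangent of the angle between them.\<close>

lemma taylor_quotient:
  fixes l v a :: "complex^2" and s :: complex
  assumes P: "poly_fun d P" and Q: "poly_fun e Q" and v: "bil v v \<noteq> 0"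
    and PQ: "\<And>l x. bil a x * Q l x = nabla a P l x"
    and a: "bil a (perp v) \<noteq> 0" and s: "s \<noteq> 0"
  defines "c \<equiv> bil a v / bil a (perp v)" and "T \<equiv> taylor v l (s *s perp v)"
  shows "T Q = fps_const (1 / (s * bil v v)) * Abs_fps (\<lambda>k. (- c / s) ^ k) *
    (fps_const c * fps_deriv (T P) + T (nabla (perp v) P))"
proof -
  let ?N = "bil v v" and ?b = "bil a (perp v)"
  let ?L = "fps_const (s * ?b) + fps_const (bil a v) * fps_X" and ?Geo = "Abs_fps (\<lambda>k. (- c / s) ^ k)"
  note p = poly_fun_nabla[OF P]
  have "nabla a P = nabla ((bil a v / ?N) *s v + (?b / ?N) *s perp v) P"
    using perp_decomp[OF v, of a] by simp
  then have 0: "nabla a P = (\<lambda>l x. (bil a v / ?N) * nabla v P l x + (?b / ?N) * nabla (perp v) P l x)"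
    unfolding nabla_linear[OF P] .
  have "T (nabla a P) = fps_const (bil a v / ?N) * fps_deriv (T P) + fps_const (?b / ?N) * T (nabla (perp v) P)"
    unfolding T_def 0
    by (subst taylor_add[OF poly_fun_cmult[OF p] poly_fun_cmult[OF p]])
       (simp only: taylor_cmult[OF p] taylor_nabla)
  moreover have "fps_const (bil a v / ?N) = fps_const (?b / ?N) * fps_const c"
    using a by (simp add: c_def)
  ultimately have 1: "T (nabla a P) = fps_const (?b / ?N) * (fps_const c * fps_deriv (T P) + T (nabla (perp v) P))"
    by (simp only: distrib_left mult.assoc)
  have "nabla a P = (\<lambda>l x. bil a x * Q l x)" using PQ by (intro ext) simp
  then have 2: "T (nabla a P) = ?L * T Q"
    unfolding T_def by (simp add: taylor_bil_mult[OF Q] bil_scale_right)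
  have "?L * ?Geo = fps_const (s * ?b)"
  proof (rule fps_ext)
    fix k show "fps_nth (?L * ?Geo) k = fps_nth (fps_const (s * ?b)) k"
      using a s by (cases k) (simp_all add: distrib_right mult.assoc c_def)
  qed
  then have "fps_const (s * ?b) * T Q = ?Geo * T (nabla a P)"
    unfolding 2 by (simp add: mult_ac)
  then have "fps_const (1 / (s * ?b)) * (fps_const (s * ?b) * T Q) =
      fps_const (1 / (s * ?b)) * (?Geo * T (nabla a P))" by simp
  moreover have "fps_const (1 / (s * ?b)) * fps_const (s * ?b) = 1"
    using a s by simp
  ultimately have "T Q = fps_const (1 / (s * ?b)) * (?Geo * T (nabla a P))"
    by (metis mult.assoc mult_1_left)
  moreover have "fps_const (1 / (s * ?b)) * fps_const (?b / ?N) = fps_const (1 / (s * ?N))"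
    using a by simp
  ultimately show ?thesis
    unfolding 1 by (metis mult.assoc mult.left_commute)
qed

lemma not_collinear_bil_perp:
  assumes "bil v v \<noteq> 0" "\<nexists>c. w = c *s v"
  shows "bil w (perp v) \<noteq> 0"
proof
  assume "bil w (perp v) = 0"
  then have "w = (bil w v / bil v v) *s v"
    using perp_decomp[OF assms(1), of w] by simp
  with assms(2) show False by blast
qed

text \<open>At a nonzero point of line j the operator has three parts. The tangential one preserves
  quasi-invariance, the poles of the other lines contribute nothing by \<open>locus\<close>, and the
  normal second derivative together with the pole of line j multiplies the coefficient of order k +
  2 by (k + 1 - 2m) (k + 2) / \<open>bil v v\<close>.\<close>

lemma quasi_inv_generic:
  assumes C: "configuration C" and L: "locus C"
    and P: "poly_fun d P" and qi: "quasi_inv C P"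
    and Q: "\<And>i. i \<in> Idx C \<Longrightarrow> poly_fun e (Q i)"
    and PQ: "\<And>i l x. i \<in> Idx C \<Longrightarrow> bil (Vec C i) x * Q i l x = nabla (Vec C i) P l x"
    and j: "j \<in> Idx C" and k: "odd k" "k < 2 * Mult C j" and s: "s \<noteq> 0"
  shows "(nabla (Vec C j) ^^ k) (\<lambda>l x. nabla_sq P l x - bil l l * P l x -
    (\<Sum>i\<in>Idx C. 2 * of_nat (Mult C i) * Q i l x)) l (s *s perp (Vec C j)) = 0"
proof -
  define v where "v = Vec C j"
  define m where "m = Mult C j"
  define T where "T = taylor v l (s *s perp v)"
  define c where "c = (\<lambda>i. bil (Vec C i) v / bil (Vec C i) (perp v))"
  let ?D = "fps_deriv (T P)" and ?G = "T (nabla (perp v) P)"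
  have fin: "finite (Idx C)" and v: "bil v v \<noteq> 0"
    using C j by (auto simp: configuration_def v_def)
  have on_line: "s *s perp v \<in> line v" for s by (simp add: line_def bil_scale_right)
  have qi_v: "(nabla v ^^ k) P l x = 0" if "odd k" "k < 2 * m" "x \<in> line v" for k x
    using qi j that unfolding quasi_inv_def v_def m_def by blast
  have qi1: "(nabla v ^^ k) (nabla (perp v) P) l x = 0" if "odd k" "k < 2 * m" "x \<in> line v" for k x
    using nabla_power_tangential[OF P v] qi_v that by blast
  have qi2: "(nabla v ^^ k) (nabla (perp v) (nabla (perp v) P)) l x = 0"
    if "odd k" "k < 2 * m" "x \<in> line v" for k x
    using nabla_power_tangential[OF poly_fun_nabla[OF P] v] qi1 that by blast
  have ev: "even_below (2 * m) (T P)" "even_below (2 * m) ?G"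
     "even_below (2 * m) (T (nabla (perp v) (nabla (perp v) P)))"
    using on_line qi_v qi1 qi2 by (auto simp: even_below_def T_def taylor_nth)
  have loc: "(\<Sum>i\<in>Idx C - {j}. of_nat (Mult C i) * c i ^ r) = 0" if "odd r" "r < 2 * m" for r
    using L j that unfolding locus_def c_def v_def m_def by blast
  have TQ: "T (Q i) = fps_const (1 / (s * bil v v)) * Abs_fps (\<lambda>k. (- c i / s) ^ k) *
     (fps_const (c i) * ?D + ?G)" if i: "i \<in> Idx C - {j}" for i
  proof -
    have "bil (Vec C i) (perp v) \<noteq> 0"
      using C i j v by (intro not_collinear_bil_perp) (auto simp: configuration_def v_def)
    then show ?thesis
      unfolding T_def c_def using i by (intro taylor_quotient[OF P Q v PQ _ s]) auto
  qed
  define R where "R = (\<Sum>i\<in>Idx C - {j}. fps_const (of_nat (Mult C i)) * T (Q i))"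
  \<comment> \<open>The geometric series of \<open>taylor_quotient\<close>, summed over i, multiply
    \<open>?D\<close> by \<open>A\<close> and \<open>?G\<close> by \<open>B\<close>. The extra
    factor \<open>c i\<close> in front of \<open>?D\<close> shifts the parity: odd powers of
    \<open>c i\<close> stand at even places of \<open>A\<close> and at odd places of
    \<open>B\<close>. Since \<open>?D\<close> is odd and \<open>?G\<close> even in the relevant
    range, \<open>locus\<close> makes both products even.\<close>
  define A where "A = Abs_fps (\<lambda>k. (- 1 / s) ^ k * (\<Sum>i\<in>Idx C - {j}. of_nat (Mult C i) * c i ^ Suc k))"
  define B where "B = Abs_fps (\<lambda>k. (- 1 / s) ^ k * (\<Sum>i\<in>Idx C - {j}. of_nat (Mult C i) * c i ^ k))"
  have AB: "A = (\<Sum>i\<in>Idx C - {j}. fps_const (of_nat (Mult C i)) * (Abs_fps (\<lambda>k. (- c i / s) ^ k) * fps_const (c i)))"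
    "B = (\<Sum>i\<in>Idx C - {j}. fps_const (of_nat (Mult C i)) * Abs_fps (\<lambda>k. (- c i / s) ^ k))"
  proof -
    have *: "(- c i / s) ^ k = (- 1 / s) ^ k * c i ^ k" for i k
      by (simp add: power_mult_distrib[symmetric])
    show "A = (\<Sum>i\<in>Idx C - {j}. fps_const (of_nat (Mult C i)) * (Abs_fps (\<lambda>k. (- c i / s) ^ k) * fps_const (c i)))"
      "B = (\<Sum>i\<in>Idx C - {j}. fps_const (of_nat (Mult C i)) * Abs_fps (\<lambda>k. (- c i / s) ^ k))"
      unfolding A_def B_def
      by (intro fps_ext, simp only: fps_sum_nth fps_mult_left_const_nth
           fps_mult_right_const_nth fps_nth_Abs_fps sum_distrib_left power_Suc *,
           intro sum.cong refl, simp only: mult_ac)+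
  qed
  have R: "R = fps_const (1 / (s * bil v v)) * (A * ?D + B * ?G)"
    unfolding R_def AB sum_distrib_right sum_distrib_left sum.distrib[symmetric]
    by (intro sum.cong refl) (simp add: TQ algebra_simps)
  have "odd_below (2 * m - 1) A"
    unfolding odd_below_def A_def
  proof (intro allI impI)
    fix k :: nat assume "k < 2 * m - 1" "even k"
    then have "odd (Suc k)" "Suc k < 2 * m" by auto
    from loc[OF this] show "fps_nth (Abs_fps (\<lambda>k. (- 1 / s) ^ k *
        (\<Sum>i\<in>Idx C - {j}. of_nat (Mult C i) * c i ^ Suc k))) k = 0"
      by (simp del: power_Suc)
  qed
  moreover have "even_below (2 * m) B"
    unfolding even_below_def B_def using loc by auto
  ultimately have "even_below (2 * m) (A * ?D + B * ?G)"
    using odd_below_mult[OF _ odd_below_deriv[OF ev(1)]] even_below_mult[OF _ ev(2)]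
    by (auto simp: even_below_def)
  then have Rk: "fps_nth R k = 0"
    using k by (auto simp: R even_below_def m_def)
  \<comment> \<open>On line j the form \<open>bil v\<close> restricts to a multiple of
    \<open>fps_X\<close>, so the division by it shifts coefficients by one place.\<close>
  have "T (nabla v P) = T (\<lambda>l x. bil v x * Q j l x)"
    using PQ[OF j] by (simp add: v_def)
  moreover have "T (\<lambda>l x. bil v x * Q j l x) = fps_const (bil v v) * (fps_X * T (Q j))"
    unfolding T_def by (subst taylor_bil_mult[OF Q[OF j]]) (simp add: bil_scale_right mult.assoc)
  ultimately have "fps_nth (T (nabla v P)) (Suc k) = bil v v * fps_nth (T (Q j)) k" by simp
  then have Qjk: "fps_nth (T (Q j)) k = of_nat (k + 2) * fps_nth (T P) (k + 2) / bil v v"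
    using v by (simp add: T_def taylor_nabla field_simps)
  have TP': "T (\<lambda>l x. nabla_sq P l x - bil l l * P l x - (\<Sum>i\<in>Idx C. 2 * of_nat (Mult C i) * Q i l x))
    = T (nabla_sq P) - fps_const (bil l l) * T P - (\<Sum>i\<in>Idx C. fps_const (2 * of_nat (Mult C i)) * T (Q i))"
    (is "T ?P' = _")
  proof -
    have 0: "poly_fun e (\<lambda>l x. \<Sum>i\<in>Idx C. 2 * of_nat (Mult C i) * Q i l x)"
      by (intro poly_fun_sum poly_fun_cmult Q)
    have 1: "poly_fun (2 + d) (\<lambda>l x. bil l l * P l x)"
      by (intro poly_fun.mult poly_fun_bil_ll P)
    have sub: "T (\<lambda>l x. f l x - g l x) = T f - T g" if "poly_fun d f" "poly_fun e g" for d e f g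
      using taylor_add[OF that(1) poly_fun_cmult[OF that(2)], of v l "s *s perp v" "-1"]
        taylor_cmult[OF that(2), of v l "s *s perp v" "-1"] by (simp add: T_def flip: fps_const_neg)
    have 2: "poly_fun (max (d + 2) (2 + d)) (\<lambda>l x. nabla_sq P l x - bil l l * P l x)"
      by (intro poly_fun_diff poly_fun.mono[OF 1] poly_fun.mono[OF poly_fun_nabla_sq[OF P]]) auto
    have 3: "T (\<lambda>l x. \<Sum>i\<in>Idx C. 2 * of_nat (Mult C i) * Q i l x)
      = (\<Sum>i\<in>Idx C. fps_const (2 * of_nat (Mult C i)) * T (Q i))"
      unfolding T_def
      by (subst taylor_sum[where d = e], rule poly_fun_cmult, erule Q, intro sum.cong refl, rule taylor_cmult, erule Q)
    show ?thesis
      unfolding sub[OF 2 0] sub[OF poly_fun_nabla_sq[OF P] 1] 3 unfolding T_def taylor_scale[OF P] ..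
  qed
  define a where "a = fps_nth (T P) (k + 2)"
  have "fps_nth (\<Sum>i\<in>Idx C. fps_const (2 * of_nat (Mult C i)) * T (Q i)) k
     = 2 * of_nat m * fps_nth (T (Q j)) k + 2 * fps_nth R k"
    unfolding R_def sum.remove[OF fin j]
    by (simp add: m_def fps_sum_nth sum_distrib_left mult.assoc)
  then have S: "fps_nth (\<Sum>i\<in>Idx C. fps_const (2 * of_nat (Mult C i)) * T (Q i)) k
     = 2 * of_nat m * (of_nat (k + 2) * a / bil v v)"
    unfolding Rk Qjk a_def by simp
  have T0: "fps_nth (T P) k = 0" "fps_nth (T (nabla (perp v) (nabla (perp v) P))) k = 0"
    using ev k by (auto simp: even_below_def m_def)
  have "fps_nth (fps_deriv (fps_deriv (T P))) k = of_nat (k + 1) * (of_nat (k + 2) * a)"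
    by (simp add: a_def)
  then have "fps_nth (T (nabla_sq P)) k = of_nat (k + 1) * (of_nat (k + 2) * a) / bil v v"
    unfolding T_def taylor_nabla_sq[OF P v]
    unfolding T_def[symmetric] fps_mult_left_const_nth fps_add_nth T0 by simp
  then have "fps_nth (T ?P') k = (of_nat (k + 1) - 2 * of_nat m) * (of_nat (k + 2) * a / bil v v)"
    unfolding TP' fps_sub_nth S fps_mult_left_const_nth T0
    by (simp only: left_diff_distrib mult_zero_right diff_zero times_divide_eq_right diff_divide_distrib)
  \<comment> \<open>Either order k + 2 is still covered by the quasi-invariance of \<open>P\<close>,
    or k is the last order 2m - 1 and the weight 2m of the pole cancels k + 1.\<close>
  also have "\<dots> = 0"
  proof (cases "k + 2 < 2 * m")
    case True
    with ev(1) k have "a = 0" by (simp add: even_below_def a_def)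
    then show ?thesis by simp
  next
    case False
    with k have "k + 1 = 2 * m" unfolding m_def by presburger
    then have "of_nat (k + 1) = (of_nat (2 * m) :: complex)" by (rule arg_cong)
    then show ?thesis by simp
  qed
  finally show ?thesis by (simp add: T_def taylor_nth v_def)
qed

text \<open>The geometric series are centred away from the common point of the lines, so the origin
  remains. The function to be tested there is polynomial, hence continuous, and vanishes at the
  origin as a limit along the line.\<close>

lemma quasi_inv_step:
  assumes C: "configuration C" and L: "locus C"
    and P: "poly_fun d P" and qi: "quasi_inv C P"
    and Q: "\<And>i. i \<in> Idx C \<Longrightarrow> poly_fun e (Q i)"
    and PQ: "\<And>i l x. i \<in> Idx C \<Longrightarrow> bil (Vec C i) x * Q i l x = nabla (Vec C i) P l x"
  shows "quasi_inv C (\<lambda>l x. nabla_sq P l x - bil l l * P l x -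
    (\<Sum>i\<in>Idx C. 2 * of_nat (Mult C i) * Q i l x))" (is "quasi_inv C ?P'")
  unfolding quasi_inv_def
proof (intro ballI allI impI)
  fix j k l x assume j: "j \<in> Idx C" and k: "odd k" "k < 2 * Mult C j" and x: "x \<in> line (Vec C j)"
  let ?g = "\<lambda>s. (nabla (Vec C j) ^^ k) ?P' l (s *s perp (Vec C j))"
  have "poly_fun (max (d + 2) e) ?P'"
    by (intro poly_fun_diff poly_fun_sum poly_fun_cmult poly_fun.mono[OF Q]
       poly_fun.mono[OF poly_fun_nabla_sq[OF P]] poly_fun.mono[OF poly_fun.mult[OF poly_fun_bil_ll P]]) auto
  from poly_fun_continuous[OF poly_fun_nabla_power[OF this]]
  have "continuous_on UNIV ?g"
    by (rule continuous_on_compose2) (auto intro!: continuous_intros simp: vector_scalar_mult_def)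
  then have "?g \<midarrow>0\<rightarrow> ?g 0"
    by (intro isContD continuous_on_interior[of UNIV]) auto
  moreover have "?g \<midarrow>0\<rightarrow> 0"
    by (rule tendsto_eventually)
      (auto simp: eventually_at_filter quasi_inv_generic[OF C L P qi Q PQ j k])
  ultimately have "?g 0 = 0" by (rule LIM_unique)
  then have "?g s = 0" for s
    using quasi_inv_generic[OF C L P qi Q PQ j k] by (cases "s = 0") auto
  moreover have "bil (Vec C j) (Vec C j) \<noteq> 0"
    using C j by (auto simp: configuration_def)
  ultimately show "(nabla (Vec C j) ^^ k) ?P' l x = 0"
    using x by (auto simp: line_perp)
qed


section \<open>The Baker-Akhiezer function of a locus configuration\<close>

text \<open>This is the operator (l, d/dx), with the spectral variable as direction. It trades a
  degree in x for a degree in l and so keeps the total degree bound.\<close>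

definition spectral_deriv :: "(complex^2 \<Rightarrow> complex^2 \<Rightarrow> complex) \<Rightarrow> complex^2 \<Rightarrow> complex^2 \<Rightarrow> complex"
  where "spectral_deriv f = (\<lambda>l x. x_deriv l f l x)"

lemma spectral_deriv_axis:
  assumes "poly_fun d f"
  shows "spectral_deriv f l x = l $ 1 * x_deriv (axis 1 1) f l x + l $ 2 * x_deriv (axis 2 1) f l x"
  unfolding spectral_deriv_def
  by (rule trans[OF arg_cong[OF axis_decomp, of "\<lambda>w. x_deriv w f l x"] x_deriv_linear[OF assms]])

lemma poly_fun_spectral_deriv:
  assumes "poly_fun d f"
  shows "poly_fun d (spectral_deriv f)"
proof -
  have "spectral_deriv f = (\<lambda>l x. l $ 1 * x_deriv (axis 1 1) f l x + l $ 2 * x_deriv (axis 2 1) f l x)"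
    by (intro ext) (rule spectral_deriv_axis[OF assms])
  moreover have "poly_fun d (\<lambda>l x. l $ i * x_deriv v f l x)" for i v
    by (rule poly_fun_mult_eq[OF poly_fun.spectral poly_fun_x_deriv[OF assms]]) simp
  ultimately show ?thesis by (simp add: poly_fun.add)
qed

text \<open>Subtracting \<open>bil l l\<close> removes the term of second degree in l. Of what
  remains, the Laplacian lowers the total degree by two and only \<open>spectral_deriv\<close> keeps
  it.\<close>

lemma nabla_sq_eq:
  assumes "poly_fun d f"
  shows "nabla_sq f l x - bil l l * f l x =
    x_deriv (axis 1 1) (x_deriv (axis 1 1) f) l x + x_deriv (axis 2 1) (x_deriv (axis 2 1) f) l x + 2 * spectral_deriv f l x"
proof -
  have "spectral_deriv f l x = l $ 1 * x_deriv (axis 1 1) f l x + l $ 2 * x_deriv (axis 2 1) f l x"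
    by (rule spectral_deriv_axis[OF assms])
  moreover have "bil (axis 1 1) l = l $ 1" "bil (axis 2 1) l = l $ 2"
    by (simp_all add: bil_def axis_def)
  ultimately show ?thesis
    by (simp add: nabla_sq_def nabla_nabla[OF assms] bil_def[of l l] algebra_simps)
qed

lemma quasi_invD:
  "quasi_inv C f \<Longrightarrow> i \<in> Idx C \<Longrightarrow> odd k \<Longrightarrow> k < 2 * Mult C i \<Longrightarrow> bil (Vec C i) x = 0 \<Longrightarrow>
    (nabla (Vec C i) ^^ k) f l x = 0"
  by (simp add: quasi_inv_def line_def)

section \<open>The product of the linear forms and the iteration of the operator\<close>

definition line_prod :: "'i config \<Rightarrow> complex^2 \<Rightarrow> complex^2 \<Rightarrow> complex"
  where "line_prod C = (\<lambda>l x. \<Prod>i\<in>Idx C. bil (Vec C i) x ^ Mult C i)"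

text \<open>The quotient of \<open>line_prod C\<close> by one linear form; the truncated subtraction
  is exact because the multiplicities of a configuration are positive.\<close>

definition line_cofactor :: "'i config \<Rightarrow> 'i \<Rightarrow> complex^2 \<Rightarrow> complex^2 \<Rightarrow> complex"
  where "line_cofactor C i = (\<lambda>l x. bil (Vec C i) x ^ (Mult C i - 1) *
    (\<Prod>j\<in>Idx C - {i}. bil (Vec C j) x ^ Mult C j))"

definition total_mult :: "'i config \<Rightarrow> nat"
  where "total_mult C = (\<Sum>i\<in>Idx C. Mult C i)"

lemma poly_fun_line_prod: "poly_fun (int (total_mult C)) (line_prod C)"
proof -
  have "poly_fun (\<Sum>i\<in>Idx C. int (Mult C i) * 1) (line_prod C)"
    unfolding line_prod_def by (intro poly_fun_prod poly_fun_power poly_fun_bil_x)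
  then show ?thesis by (simp add: total_mult_def)
qed

lemma poly_fun_spectral_deriv_power: "poly_fun (int (total_mult C)) ((spectral_deriv ^^ k) (line_prod C))"
  by (induction k) (simp_all add: poly_fun_line_prod poly_fun_spectral_deriv)

context
  fixes C :: "'i config"
  assumes C: "configuration C"
begin

lemma line_prod_eq: "i \<in> Idx C \<Longrightarrow> line_prod C l x = bil (Vec C i) x * line_cofactor C i l x"
  using C unfolding line_prod_def line_cofactor_def configuration_def
  by (cases "Mult C i") (auto simp: prod.remove mult.assoc)

lemma poly_fun_line_cofactor:
  assumes i: "i \<in> Idx C"
  shows "poly_fun (int (total_mult C) - 1) (line_cofactor C i)"
proof -
  have "poly_fun (int (Mult C i - 1) * 1 + (\<Sum>j\<in>Idx C - {i}. int (Mult C j) * 1)) (line_cofactor C i)"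
    unfolding line_cofactor_def
    by (intro poly_fun.mult poly_fun_prod poly_fun_power poly_fun_bil_x)
  moreover have "0 < Mult C i" "finite (Idx C)" using i C by (auto simp: configuration_def)
  then have "int (Mult C i - 1) * 1 + (\<Sum>j\<in>Idx C - {i}. int (Mult C j) * 1) = int (total_mult C) - 1"
    using i by (simp add: total_mult_def sum.remove of_nat_diff algebra_simps)
  ultimately show ?thesis by simp
qed

text \<open>The logarithmic derivative of the product, cleared of denominators.\<close>

lemma spectral_deriv_line_prod:
  "spectral_deriv (line_prod C) l x = (\<Sum>i\<in>Idx C. of_nat (Mult C i) * bil (Vec C i) l * line_cofactor C i l x)"
proof -
  have "((\<lambda>t. \<Prod>i\<in>Idx C. bil (Vec C i) (x + t *s v) ^ Mult C i) has_field_derivative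
     (\<Sum>i\<in>Idx C. (of_nat (Mult C i) * bil (Vec C i) v * bil (Vec C i) (x + 0 *s v) ^ (Mult C i - 1)) *
       (\<Prod>j\<in>Idx C - {i}. bil (Vec C j) (x + 0 *s v) ^ Mult C j))) (at 0)" for x v
    by (rule has_field_derivative_prod)
       (auto intro!: derivative_eq_intros simp: bil_add_right bil_scale_right)
  then have "x_deriv v (line_prod C) = (\<lambda>l x. \<Sum>i\<in>Idx C. of_nat (Mult C i) * bil (Vec C i) v * line_cofactor C i l x)" for v
    by (intro x_deriv_eqI) (simp add: line_prod_def line_cofactor_def mult.assoc)
  then show ?thesis by (simp add: spectral_deriv_def)
qed

text \<open>The product rule gives d_l (A B) = (d_l A) B + A d_l B, and the first summand is what
  the poles subtract in top degree. Everything else has degree below 2M and is absorbed by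
  \<open>g'\<close>.\<close>

lemma BA_step:
  assumes L: "locus C"
    and B: "poly_fun (int (total_mult C)) B" and g: "poly_fun (2 * int (total_mult C) - 1) g"
    and qi: "quasi_inv C (\<lambda>l x. line_prod C l x * B l x + g l x)"
  shows "\<exists>g'. poly_fun (2 * int (total_mult C) - 1) g' \<and>
    quasi_inv C (\<lambda>l x. line_prod C l x * spectral_deriv B l x + g' l x)"
proof -
  define M where "M = int (total_mult C)"
  define A where "A = line_prod C"
  define P where "P = (\<lambda>l x. A l x * B l x + g l x)"
  have A: "poly_fun M A" and B: "poly_fun M B" and g: "poly_fun (2 * M - 1) g"
    using poly_fun_line_prod B g by (auto simp: M_def A_def)
  have AB: "poly_fun (2 * M) (\<lambda>l x. A l x * B l x)"
    by (rule poly_fun_mult_eq[OF A B]) simp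
  have P: "poly_fun (2 * M) P"
    unfolding P_def by (intro poly_fun.add AB poly_fun.mono[OF g]) simp
  have qi: "quasi_inv C P" using qi by (simp add: P_def A_def)
  \<comment> \<open>Dividing \<open>nabla (Vec C i) P\<close> as a whole would bound the quotient by
    2M only and hide its leading part. The summand \<open>bil (Vec C i) l * A l x * B l x\<close> is
    therefore set aside, being divisible by \<open>line_prod_eq\<close>; the rest has degree 2M and
    leaves a quotient of degree 2M - 1.\<close>
  have "\<exists>K. poly_fun (2 * M - 1) K \<and>
      (\<forall>l x. x_deriv (Vec C i) P l x + bil (Vec C i) l * g l x = bil (Vec C i) x * K l x)"
    if i: "i \<in> Idx C" for i
  proof -
    let ?v = "Vec C i"
    have vanish: "x_deriv ?v P l x + bil ?v l * g l x = 0" if "bil ?v x = 0" for l x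
    proof -
      have "0 < Mult C i" using C i by (simp add: configuration_def)
      then have "(nabla ?v ^^ 1) P l x = 0"
        using that by (intro quasi_invD[OF qi i]) auto
      moreover have "A l x = 0" using that line_prod_eq[OF i] by (simp add: A_def)
      ultimately show ?thesis by (simp add: nabla_def P_def)
    qed
    have v: "bil ?v ?v \<noteq> 0" using C i by (simp add: configuration_def)
    have "poly_fun (2 * M) (\<lambda>l x. x_deriv ?v P l x + bil ?v l * g l x)"
      by (intro poly_fun.add poly_fun.mono[OF poly_fun_x_deriv[OF P]]
          poly_fun_mult_eq[OF poly_fun_bil_l g]) auto
    then show ?thesis by (rule poly_fun_divide_linear[OF _ v vanish])
  qed
  then have "\<forall>i\<in>Idx C. \<exists>K. poly_fun (2 * M - 1) K \<and>
      (\<forall>l x. x_deriv (Vec C i) P l x + bil (Vec C i) l * g l x = bil (Vec C i) x * K l x)" ..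
  from bchoice[OF this] obtain K where
    K0: "\<forall>i\<in>Idx C. poly_fun (2 * M - 1) (K i) \<and>
      (\<forall>l x. x_deriv (Vec C i) P l x + bil (Vec C i) l * g l x = bil (Vec C i) x * K i l x)" ..
  have K: "poly_fun (2 * M - 1) (K i)"
    "x_deriv (Vec C i) P l x + bil (Vec C i) l * g l x = bil (Vec C i) x * K i l x"
    if "i \<in> Idx C" for i l x
    using bspec[OF K0 that] by simp_all
  define Q where "Q = (\<lambda>i l x. K i l x + bil (Vec C i) l * line_cofactor C i l x * B l x)"
  have Q: "poly_fun (2 * M) (Q i)" if i: "i \<in> Idx C" for i
  proof -
    have "poly_fun M (\<lambda>l x. bil (Vec C i) l * line_cofactor C i l x)"
      by (rule poly_fun_mult_eq[OF poly_fun_bil_l poly_fun_line_cofactor[OF i]]) (simp add: M_def)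
    then show ?thesis
      unfolding Q_def
      by (intro poly_fun.add poly_fun.mono[OF K(1)[OF i]] poly_fun_mult_eq[OF _ B]) auto
  qed
  have PQ: "bil (Vec C i) x * Q i l x = nabla (Vec C i) P l x" if i: "i \<in> Idx C" for i l x
  proof -
    have "bil (Vec C i) x * Q i l x =
        bil (Vec C i) x * K i l x + bil (Vec C i) l * (bil (Vec C i) x * line_cofactor C i l x) * B l x"
      by (simp add: Q_def algebra_simps)
    also have "\<dots> = x_deriv (Vec C i) P l x + bil (Vec C i) l * g l x + bil (Vec C i) l * A l x * B l x"
      using K(2)[OF i, symmetric] line_prod_eq[OF i, symmetric] by (simp add: A_def)
    finally show ?thesis by (simp add: nabla_def P_def algebra_simps)
  qed
  \<comment> \<open>Half of the image of \<open>P\<close> without its leading part: the Laplacian,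
    the derivative of the old remainder and the quotients \<open>K\<close>.\<close>
  define g' where "g' = (\<lambda>l x. (1/2) * (x_deriv (axis 1 1) (x_deriv (axis 1 1) P) l x + x_deriv (axis 2 1) (x_deriv (axis 2 1) P) l x)
     + spectral_deriv g l x - (\<Sum>i\<in>Idx C. of_nat (Mult C i) * K i l x))"
  have g': "poly_fun (2 * M - 1) g'"
    unfolding g'_def using K(1)
    by (intro poly_fun_diff poly_fun.add poly_fun_cmult poly_fun_sum poly_fun_spectral_deriv[OF g]
          poly_fun.mono[OF poly_fun_x_deriv[OF poly_fun_x_deriv[OF P]]]) auto
  have dlP: "spectral_deriv P l x = spectral_deriv A l x * B l x + A l x * spectral_deriv B l x + spectral_deriv g l x" for l x
    unfolding spectral_deriv_def P_def x_deriv_add[OF AB g] x_deriv_mult[OF A B] ..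
  have *: "nabla_sq P l x - bil l l * P l x - (\<Sum>i\<in>Idx C. 2 * of_nat (Mult C i) * Q i l x)
    = 2 * (A l x * spectral_deriv B l x + g' l x)" for l x
  proof -
    have "(\<Sum>i\<in>Idx C. 2 * of_nat (Mult C i) * Q i l x) =
      2 * (\<Sum>i\<in>Idx C. of_nat (Mult C i) * K i l x) + 2 * (spectral_deriv A l x * B l x)"
      unfolding A_def spectral_deriv_line_prod Q_def sum_distrib_left sum_distrib_right sum.distrib[symmetric]
      by (intro sum.cong refl) (simp add: algebra_simps)
    then show ?thesis
      unfolding nabla_sq_eq[OF P] dlP by (simp add: g'_def algebra_simps)
  qed
  have "poly_fun (2 * M) (\<lambda>l x. A l x * spectral_deriv B l x + g' l x)"
    by (intro poly_fun.add poly_fun_mult_eq[OF A poly_fun_spectral_deriv[OF B]] poly_fun.mono[OF g']) auto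
  note sc = nabla_power_scale[OF this, of _ _ "\<lambda>_. 2"]
  have "quasi_inv C (\<lambda>l x. 2 * (A l x * spectral_deriv B l x + g' l x))"
    using quasi_inv_step[OF C L P qi Q PQ] unfolding * by simp
  then have "quasi_inv C (\<lambda>l x. A l x * spectral_deriv B l x + g' l x)"
    unfolding quasi_inv_def sc by simp
  with g' show ?thesis unfolding M_def A_def by blast
qed

text \<open>The start is A^2, with zero remainder. It contains the form of line i to the power
  \<open>2 * Mult C i\<close>, so that every conjugated derivative of smaller order vanishes there,
  whatever its parity.\<close>

lemma BA_iterate:
  assumes L: "locus C"
  shows "\<exists>g. poly_fun (2 * int (total_mult C) - 1) g \<and>
    quasi_inv C (\<lambda>l x. line_prod C l x * (spectral_deriv ^^ k) (line_prod C) l x + g l x)"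
proof (induction k)
  case 0
  have "quasi_inv C (\<lambda>l x. line_prod C l x * line_prod C l x + 0)"
    unfolding quasi_inv_def
  proof (intro ballI allI impI)
    fix i k l x assume i: "i \<in> Idx C" and k: "k < 2 * Mult C i" and x: "x \<in> line (Vec C i)"
    let ?R = "\<lambda>l x. (\<Prod>j\<in>Idx C - {i}. bil (Vec C j) x ^ Mult C j) * (\<Prod>j\<in>Idx C - {i}. bil (Vec C j) x ^ Mult C j)"
    have fin: "finite (Idx C)" using C by (simp add: configuration_def)
    have "(\<lambda>l x. line_prod C l x * line_prod C l x + 0) = (\<lambda>l x. bil (Vec C i) x ^ (2 * Mult C i) * ?R l x)"
      by (simp only: line_prod_def prod.remove[OF fin i] mult_2 power_add add_0_right)
         (simp only: mult_ac)
    moreover have "poly_fun ((\<Sum>j\<in>Idx C - {i}. int (Mult C j) * 1) + (\<Sum>j\<in>Idx C - {i}. int (Mult C j) * 1)) ?R"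
      by (intro poly_fun.mult poly_fun_prod poly_fun_power poly_fun_bil_x)
    ultimately show "(nabla (Vec C i) ^^ k) (\<lambda>l x. line_prod C l x * line_prod C l x + 0) l x = 0"
      using nabla_power_vanish[OF _ _ k] x by (simp add: line_def)
  qed
  then show ?case by (intro exI[of _ "\<lambda>l x. 0"]) (simp add: poly_fun.zero)
next
  case (Suc k)
  with BA_step[OF L poly_fun_spectral_deriv_power] show ?case by auto
qed

end

section \<open>Restriction to a line, and return to ordinary derivatives\<close>

lemma dir_deriv_power_poly:
  assumes "\<And>t. f (x + t *s v) = poly p t"
  shows "(dir_deriv v ^^ k) f (x + t *s v) = poly ((pderiv ^^ k) p) t"
proof (induction k arbitrary: t)
  case (Suc k)
  have eq: "(x + t *s v) + s *s v = x + (t + s) *s v" for s by (simp add: vector_sadd_rdistrib)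
  have "(dir_deriv v ^^ Suc k) f (x + t *s v) = deriv (\<lambda>s. poly ((pderiv ^^ k) p) (t + s)) 0"
    by (simp only: funpow.simps o_apply dir_deriv_def[of v "(dir_deriv v ^^ k) f"] eq Suc)
  also have "\<dots> = poly (pderiv ((pderiv ^^ k) p)) t"
    by (rule DERIV_imp_deriv) (auto intro!: derivative_eq_intros)
  finally show ?case by simp
qed (simp add: assms)

text \<open>Coefficients are read off at a bound for the degree, not at the degree itself: the
  factors it is meant for have leading coefficient \<open>bil (Vec C i) l\<close>, which is zero for
  some l.\<close>

lemma coeff_mult_degree_le:
  assumes "degree p \<le> a" "degree q \<le> b"
  shows "coeff (p * q) (a + b) = coeff p a * coeff q b"
proof -
  have "coeff p i * coeff q (a + b - i) = 0" if "i \<noteq> a" for i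
    using that assms by (cases "i < a") (auto simp: coeff_eq_0)
  then have "(\<Sum>i\<le>a + b. coeff p i * coeff q (a + b - i)) = (\<Sum>i\<in>{a}. coeff p i * coeff q (a + b - i))"
    by (intro sum.mono_neutral_right) auto
  then show ?thesis by (simp add: coeff_mult)
qed

lemma coeff_linear_power:
  "degree ([:a, b:] ^ k) \<le> k \<and> coeff ([:a, b:] ^ k) k = (b :: 'a :: comm_semiring_1) ^ k"
proof (induction k)
  case (Suc k)
  have 1: "degree [:a, b:] \<le> 1" by simp
  then have "degree ([:a, b:] * [:a, b:] ^ k) \<le> 1 + k"
    using Suc by (intro order_trans[OF degree_mult_le] add_mono) auto
  with coeff_mult_degree_le[OF 1 Suc[THEN conjunct1]] Suc show ?case
    unfolding power_Suc plus_1_eq_Suc by simp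
qed simp

lemma coeff_prod_degree_le:
  assumes "\<And>i. i \<in> I \<Longrightarrow> degree (p i) \<le> d i"
  shows "degree (\<Prod>i\<in>I. p i) \<le> (\<Sum>i\<in>I. d i) \<and>
    coeff (\<Prod>i\<in>I. p i) (\<Sum>i\<in>I. d i) = (\<Prod>i\<in>I. coeff (p i) (d i))"
  using assms
proof (induction I rule: infinite_finite_induct)
  case (insert i I)
  then have "degree (p i) \<le> d i" "degree (\<Prod>i\<in>I. p i) \<le> (\<Sum>i\<in>I. d i)" by auto
  with coeff_mult_degree_le[OF this] order_trans[OF degree_mult_le add_mono[OF this]] insert
  show ?case by auto
qed auto

text \<open>On the line x + t l the product is a polynomial in t of degree at most M with
  coefficient A(l) at t^M. Its M-th derivative is the constant M! A(l), whatever x is.\<close>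

lemma spectral_deriv_power_line_prod:
  "(spectral_deriv ^^ total_mult C) (line_prod C) l x = fact (total_mult C) * line_prod C l l"
proof -
  let ?M = "total_mult C"
  let ?p = "\<Prod>i\<in>Idx C. [:bil (Vec C i) x, bil (Vec C i) l:] ^ Mult C i"
  \<comment> \<open>The spectral variable is fixed while x varies, so the iterate differentiates in
    one constant direction.\<close>
  have "(spectral_deriv ^^ k) f l = (dir_deriv l ^^ k) (f l)" for k f
    by (induction k) (auto simp: spectral_deriv_def x_deriv_def)
  then have "(spectral_deriv ^^ ?M) (line_prod C) l x = (dir_deriv l ^^ ?M) (line_prod C l) (x + 0 *s l)" by simp
  also have "\<dots> = poly ((pderiv ^^ ?M) ?p) 0"
    by (rule dir_deriv_power_poly)
       (simp add: line_prod_def poly_prod bil_add_right bil_scale_right)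
  also have "\<dots> = fact ?M * coeff ?p ?M"
    by (simp add: poly_0_coeff_0 coeff_higher_pderiv pochhammer_fact flip: of_nat_fact)
  also have "coeff ?p ?M = (\<Prod>i\<in>Idx C. coeff ([:bil (Vec C i) x, bil (Vec C i) l:] ^ Mult C i) (Mult C i))"
    unfolding total_mult_def by (intro coeff_prod_degree_le[THEN conjunct2]) (simp add: coeff_linear_power)
  also have "\<dots> = line_prod C l l" by (simp add: coeff_linear_power line_prod_def)
  finally show ?thesis .
qed

text \<open>Turns quasi-invariance back into the vanishing of ordinary derivatives demanded of a
  Baker-Akhiezer function.\<close>

lemma dir_deriv_power_exp:
  assumes "poly_fun d f"
  shows "(dir_deriv v ^^ k) (\<lambda>x. f l x * exp (bil l x)) = (\<lambda>x. (nabla v ^^ k) f l x * exp (bil l x))"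
proof (induction k)
  case (Suc k)
  let ?g = "(nabla v ^^ k) f"
  have g: "poly_fun (d + int k) ?g" by (rule poly_fun_nabla_power[OF assms])
  have "dir_deriv v (\<lambda>x. ?g l x * exp (bil l x)) x = nabla v ?g l x * exp (bil l x)" for x
  proof (rule dir_derivI)
    have "((\<lambda>t. exp (bil l (x + t *s v))) has_field_derivative exp (bil l x) * bil v l) (at 0)"
      by (auto intro!: derivative_eq_intros simp: bil_add_right bil_scale_right bil_commute)
    from DERIV_mult[OF poly_fun_has_x_deriv[OF g] this]
    show "((\<lambda>t. ?g l (x + t *s v) * exp (bil l (x + t *s v))) has_field_derivative
        nabla v ?g l x * exp (bil l x)) (at 0)"
      by (simp add: nabla_def algebra_simps)
  qed
  with Suc show ?case by auto
qed simp

section \<open>Formal polynomials and their highest terms\<close>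

definition monom_lx :: "(nat^2) \<times> (nat^2) \<Rightarrow> complex^2 \<Rightarrow> complex^2 \<Rightarrow> complex"
  where "monom_lx e l x = (\<Prod>i\<in>UNIV. l $ i ^ (fst e $ i)) * (\<Prod>i\<in>UNIV. x $ i ^ (snd e $ i))"

lemma term_lx_eq: "term_lx p l x e = Poly_Mapping.lookup p e * monom_lx e l x"
  by (simp add: term_lx_def monom_lx_def mult.assoc)

lemma monom_lx_add: "monom_lx (a + b) l x = monom_lx a l x * monom_lx b l x"
  by (simp add: monom_lx_def power_add prod.distrib mult_ac)

lemma exponent_degree_add: "exponent_degree (a + b) = exponent_degree a + exponent_degree b"
  by (simp add: exponent_degree_def sum.distrib)

lemma eval_lx_add: "eval_lx (p + q) l x = eval_lx p l x + eval_lx q l x"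
  unfolding eval_lx_def term_lx_eq
  by (rule setsum_keys_plus_distrib[of "\<lambda>e c. c * monom_lx e l x"]) (auto simp: distrib_right)

lemma eval_lx_sum: "eval_lx (\<Sum>i\<in>I. p i) l x = (\<Sum>i\<in>I. eval_lx (p i) l x)"
  by (induction I rule: infinite_finite_induct) (auto simp: eval_lx_add, auto simp: eval_lx_def)

lemma eval_lx_single: "eval_lx (Poly_Mapping.single e c) l x = c * monom_lx e l x"
  by (simp add: eval_lx_def term_lx_eq)

text \<open>A set of admissible degrees serves two purposes: a singleton expresses homogeneity of
  the leading part, and \<open>{..d}\<close> bounds the remainder.\<close>

definition representable :: "int set \<Rightarrow> (complex^2 \<Rightarrow> complex^2 \<Rightarrow> complex) \<Rightarrow> bool"
  where "representable D f \<longleftrightarrow> (\<exists>p. (\<forall>e\<in>Poly_Mapping.keys p. int (exponent_degree e) \<in> D) \<and>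
    (\<forall>l x. eval_lx p l x = f l x))"

lemma representable_monom:
  "int (exponent_degree e) \<in> D \<Longrightarrow> representable D (\<lambda>l x. c * monom_lx e l x)"
  unfolding representable_def
  by (intro exI[of _ "Poly_Mapping.single e c"]) (auto simp: eval_lx_single split: if_splits)

lemma representable_const: "0 \<in> D \<Longrightarrow> representable D (\<lambda>l x. c)"
  using representable_monom[of 0 D c] by (simp add: monom_lx_def exponent_degree_def)

lemma representable_l: "1 \<in> D \<Longrightarrow> representable D (\<lambda>l x. l $ i)"
  using representable_monom[of "(axis i 1, 0)" D 1] exhaust_2[of i]
  by (auto simp: monom_lx_def exponent_degree_def axis_def UNIV_2)

lemma representable_x: "1 \<in> D \<Longrightarrow> representable D (\<lambda>l x. x $ i)"
  using representable_monom[of "(0, axis i 1)" D 1] exhaust_2[of i]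
  by (auto simp: monom_lx_def exponent_degree_def axis_def UNIV_2)

lemma representable_add:
  assumes "representable D f" "representable D g"
  shows "representable D (\<lambda>l x. f l x + g l x)"
proof -
  obtain p q where "\<forall>e\<in>Poly_Mapping.keys p. int (exponent_degree e) \<in> D" "\<forall>l x. eval_lx p l x = f l x"
    "\<forall>e\<in>Poly_Mapping.keys q. int (exponent_degree e) \<in> D" "\<forall>l x. eval_lx q l x = g l x"
    using assms unfolding representable_def by blast
  then show ?thesis
    unfolding representable_def using keys_add[of p q]
    by (intro exI[of _ "p + q"]) (auto simp: eval_lx_add)
qed

lemma representable_mult:
  assumes "representable D f" "representable E g" "\<And>a b. a \<in> D \<Longrightarrow> b \<in> E \<Longrightarrow> a + b \<in> F"
  shows "representable F (\<lambda>l x. f l x * g l x)"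
proof -
  obtain p q where pq: "\<forall>e\<in>Poly_Mapping.keys p. int (exponent_degree e) \<in> D" "\<forall>l x. eval_lx p l x = f l x"
    "\<forall>e\<in>Poly_Mapping.keys q. int (exponent_degree e) \<in> E" "\<forall>l x. eval_lx q l x = g l x"
    using assms unfolding representable_def by blast
  let ?r = "\<Sum>a\<in>Poly_Mapping.keys p. \<Sum>b\<in>Poly_Mapping.keys q.
    Poly_Mapping.single (a + b) (Poly_Mapping.lookup p a * Poly_Mapping.lookup q b)"
  have "Poly_Mapping.keys ?r \<subseteq> (\<Union>a\<in>Poly_Mapping.keys p. \<Union>b\<in>Poly_Mapping.keys q. {a + b})"
    by (intro order_trans[OF keys_sum] UN_mono order_refl) simp
  moreover have "int (exponent_degree (a + b)) \<in> F"
    if "a \<in> Poly_Mapping.keys p" "b \<in> Poly_Mapping.keys q" for a b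
    using pq(1,3) assms(3) that by (simp add: exponent_degree_add)
  ultimately have "\<forall>e\<in>Poly_Mapping.keys ?r. int (exponent_degree e) \<in> F"
    by blast
  moreover have "eval_lx ?r l x = f l x * g l x" for l x
  proof -
    have "eval_lx ?r l x = eval_lx p l x * eval_lx q l x"
      unfolding eval_lx_sum eval_lx_single eval_lx_def[of p] eval_lx_def[of q] term_lx_eq
        monom_lx_add sum_product
      by (intro sum.cong refl) (simp add: mult_ac)
    with pq show ?thesis by simp
  qed
  ultimately show ?thesis unfolding representable_def by blast
qed

lemma representable_mono: "representable D f \<Longrightarrow> D \<subseteq> E \<Longrightarrow> representable E f"
  unfolding representable_def by blast

lemma poly_fun_representable: "poly_fun d f \<Longrightarrow> representable {..d} f"
proof (induction rule: poly_fun.induct)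
  case (zero d)
  show ?case unfolding representable_def by (intro exI[of _ 0]) (simp add: eval_lx_def)
next
  case (mult d f e g)
  then show ?case by (elim representable_mult) auto
next
  case (mono d f e)
  then show ?case by (auto elim: representable_mono)
qed (auto intro: representable_const representable_l representable_x representable_add)

lemma representable_cmult: "representable D f \<Longrightarrow> representable D (\<lambda>l x. c * f l x)"
  by (rule representable_mult[OF representable_const[of "{0}"]]) auto

lemma representable_bil_l: "representable {1} (\<lambda>l x. bil a l)"
  and representable_bil_x: "representable {1} (\<lambda>l x. bil a x)"
  unfolding bil_def
  by (intro representable_add representable_cmult representable_l representable_x singletonI)+

lemma representable_power:
  "representable {d} f \<Longrightarrow> representable {int k * d} (\<lambda>l x. f l x ^ k)"
proof (induction k)
  case (Suc k)
  then show ?case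
    using representable_mult[of "{d}" f "{int k * d}" "\<lambda>l x. f l x ^ k" "{int (Suc k) * d}"]
    by (simp add: algebra_simps)
qed (simp add: representable_const)

lemma representable_prod:
  "(\<And>i. i \<in> I \<Longrightarrow> representable {d i} (f i)) \<Longrightarrow>
    representable {\<Sum>i\<in>I. d i} (\<lambda>l x. \<Prod>i\<in>I. f i l x)"
proof (induction I rule: infinite_finite_induct)
  case (insert i I)
  then show ?case
    using representable_mult[of "{d i}" "f i" "{\<Sum>i\<in>I. d i}" "\<lambda>l x. \<Prod>i\<in>I. f i l x" "{\<Sum>i\<in>insert i I. d i}"]
    by simp
qed (simp_all add: representable_const)

text \<open>On the points (1, t) each factor becomes a nonzero polynomial in t, because a
  non-isotropic vector is nonzero; the product then has a non-root.\<close>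

lemma line_prod_nonzero:
  assumes "configuration C"
  obtains x where "line_prod C l x \<noteq> 0"
proof -
  let ?p = "\<Prod>i\<in>Idx C. [:Vec C i $ 1, Vec C i $ 2:] ^ Mult C i"
  have "Vec C i $ 1 \<noteq> 0 \<or> Vec C i $ 2 \<noteq> 0" if "i \<in> Idx C" for i
    using assms that by (auto simp: configuration_def bil_def)
  then have "?p \<noteq> 0"
    using assms by (auto simp: configuration_def)
  then obtain t where "poly ?p t \<noteq> 0" using poly_all_0_iff_0 by blast
  then have "line_prod C l (vector [1, t]) \<noteq> 0"
    by (simp add: line_prod_def poly_prod bil_def mult.commute)
  then show ?thesis by (rule that)
qed

text \<open>The degrees keep the two sets of keys disjoint, so nothing cancels, and
  \<open>p \<noteq> 0\<close> ensures that degree d occurs.\<close>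

lemma highest_termI:
  assumes p: "\<And>e. e \<in> Poly_Mapping.keys p \<Longrightarrow> int (exponent_degree e) = d"
    and q: "\<And>e. e \<in> Poly_Mapping.keys q \<Longrightarrow> int (exponent_degree e) < d"
    and nz: "p \<noteq> 0"
  shows "highest_term (p + q) l x = eval_lx p l x"
proof -
  have lk: "Poly_Mapping.lookup q e = 0" if "e \<in> Poly_Mapping.keys p" for e
    using p[OF that] q[of e] by (auto simp: in_keys_iff)
  have keys: "Poly_Mapping.keys p \<subseteq> Poly_Mapping.keys (p + q)"
    using lk by (auto simp: in_keys_iff lookup_add)
  have "Poly_Mapping.keys p \<noteq> {}" using nz by simp
  then obtain e where e: "e \<in> Poly_Mapping.keys p" by blast
  have "int (degree_lx (p + q)) = d"
  proof -
    have "exponent_degree e' \<le> nat d" if "e' \<in> Poly_Mapping.keys (p + q)" for e'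
      using that keys_add[of p q] p[of e'] q[of e'] by fastforce
    moreover have "nat d \<in> exponent_degree ` Poly_Mapping.keys (p + q)"
      using p[OF e] keys e by force
    ultimately have "degree_lx (p + q) = nat d"
      unfolding degree_lx_def by (intro Max_eqI) auto
    with p[OF e] show ?thesis by simp
  qed
  then have "{e \<in> Poly_Mapping.keys (p + q). exponent_degree e = degree_lx (p + q)} = Poly_Mapping.keys p"
    using keys keys_add[of p q] p q by fastforce
  then show ?thesis
    by (simp add: highest_term_def eval_lx_def term_lx_eq lookup_add lk)
qed

theorem locus_admits_BA:
  assumes C: "configuration C" and L: "locus C"
  shows "admits_BA C"
proof -
  let ?M = "total_mult C"
  obtain g where g: "poly_fun (2 * int ?M - 1) g"
    "quasi_inv C (\<lambda>l x. line_prod C l x * (spectral_deriv ^^ ?M) (line_prod C) l x + g l x)"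
    using BA_iterate[OF C L] by blast
  \<comment> \<open>The prescribed highest term. The iteration yields M! times it, so the remainder
    is divided by M! as well.\<close>
  define h where "h = (\<lambda>l x. line_prod C l l * line_prod C l x)"
  define r where "r = (\<lambda>l x. (1 / fact ?M) * g l x)"
  have h_eq: "h l x = (\<Prod>i\<in>Idx C. bil (Vec C i) l ^ Mult C i * bil (Vec C i) x ^ Mult C i)" for l x
    by (simp add: h_def line_prod_def prod.distrib)
  have "representable {(\<Sum>i\<in>Idx C. int (Mult C i) * 1 + int (Mult C i) * 1)} h"
    unfolding h_eq
    by (intro representable_prod representable_mult[OF representable_power[OF representable_bil_l]
          representable_power[OF representable_bil_x]]) auto
  then have "representable {2 * int ?M} h"
    by (simp add: total_mult_def sum_distrib_left)
  then obtain p where p: "\<And>e. e \<in> Poly_Mapping.keys p \<Longrightarrow> int (exponent_degree e) = 2 * int ?M"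
    "\<And>l x. eval_lx p l x = h l x"
    unfolding representable_def by blast
  have r: "poly_fun (2 * int ?M - 1) r" unfolding r_def by (rule poly_fun_cmult[OF g(1)])
  from poly_fun_representable[OF this]
  obtain q where q: "\<And>e. e \<in> Poly_Mapping.keys q \<Longrightarrow> int (exponent_degree e) < 2 * int ?M"
    "\<And>l x. eval_lx q l x = r l x"
    unfolding representable_def by fastforce
  have "p \<noteq> 0"
  proof
    assume "p = 0"
    then have h0: "h l x = 0" for l x using p(2)[of l x] by (simp add: eval_lx_def)
    \<comment> \<open>\<open>line_prod\<close> ignores its first argument, so the point found can be
      put in both places.\<close>
    obtain l where "line_prod C l l \<noteq> 0"
      using line_prod_nonzero[OF C] by (metis line_prod_def)
    with h0[of l l] show False by (simp add: h_def)
  qed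
  with p(1) q(1) have ht: "highest_term (p + q) l x = eval_lx p l x" for l x
    by (rule highest_termI)
  define f where "f = (\<lambda>l x. h l x + r l x)"
  have pl: "poly_fun (2 * int ?M) (\<lambda>l x. line_prod C l x * (spectral_deriv ^^ ?M) (line_prod C) l x + g l x)"
    by (intro poly_fun.add poly_fun_mult_eq[OF poly_fun_line_prod poly_fun_spectral_deriv_power]
        poly_fun.mono[OF g(1)]) auto
  have f_eq: "f = (\<lambda>l x. (1 / fact ?M) * (line_prod C l x * (spectral_deriv ^^ ?M) (line_prod C) l x + g l x))"
    by (intro ext) (simp add: f_def h_def r_def spectral_deriv_power_line_prod distrib_left)
  have f: "poly_fun (2 * int ?M) f"
    unfolding f_eq by (rule poly_fun_cmult[OF pl])
  have qi: "quasi_inv C f"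
    using g(2) unfolding quasi_inv_def f_eq nabla_power_scale[OF pl, of _ _ "\<lambda>_. 1 / fact ?M"] by simp
  have "is_BA_function C (\<lambda>l x. f l x * exp (bil l x))"
    unfolding is_BA_function_def
  proof (intro conjI exI[of _ "p + q"] allI ballI)
    fix l x show "f l x * exp (bil l x) = eval_lx (p + q) l x * exp (bil l x)"
      by (simp add: eval_lx_add p q f_def)
  next
    fix l x show "highest_term (p + q) l x =
        (\<Prod>i\<in>Idx C. bil (Vec C i) l ^ Mult C i * bil (Vec C i) x ^ Mult C i)"
      by (simp add: ht p(2) h_eq)
  next
    fix i s l x assume "i \<in> Idx C" "s \<in> {1..Mult C i}" "x \<in> line (Vec C i)"
    then have "(nabla (Vec C i) ^^ (2 * s - 1)) f l x = 0"
      by (intro quasi_invD[OF qi]) (auto simp: line_def)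
    then show "(dir_deriv (Vec C i) ^^ (2 * s - 1)) (\<lambda>x. f l x * exp (bil l x)) x = 0"
      by (simp add: dir_deriv_power_exp[OF f])
  qed
  then show ?thesis unfolding admits_BA_def by blast
qed


section \<open>Cotangent sums\<close>

text \<open>Congruence of angles modulo pi is expressed throughout as the vanishing of the sine of
  their difference; these are its closure rules.\<close>

lemma sin_zero_add: "sin a = 0 \<Longrightarrow> sin b = 0 \<Longrightarrow> sin (a + b :: real) = 0"
  and sin_zero_diff: "sin a = 0 \<Longrightarrow> sin b = 0 \<Longrightarrow> sin (a - b :: real) = 0"
  by (simp_all add: sin_add sin_diff)

lemma sin_zero_of_nat_mult: "sin x = 0 \<Longrightarrow> sin (of_nat q * x :: real) = 0"
  by (induction q) (auto simp: distrib_right intro: sin_zero_add)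

lemma unit_vec_nth [simp]: "unit_vec a $ 1 = of_real (cos a)" "unit_vec a $ 2 = of_real (sin a)"
  by (simp_all add: unit_vec_def)

lemma bil_unit_vec: "bil (unit_vec a) (unit_vec b) = of_real (cos (a - b))"
  by (simp add: bil_def cos_diff)

lemma bil_unit_vec_self [simp]: "bil (unit_vec a) (unit_vec a) = 1"
  by (simp add: bil_unit_vec)

lemma bil_unit_vec_perp: "bil (unit_vec a) (perp (unit_vec b)) = of_real (sin (a - b))"
  by (simp add: bil_def sin_diff)

lemma unit_vec_collinear_iff: "(\<exists>c. unit_vec a = c *s unit_vec b) \<longleftrightarrow> sin (a - b) = 0"
proof
  assume "\<exists>c. unit_vec a = c *s unit_vec b"
  then obtain c where "unit_vec a = c *s unit_vec b" by blast
  then have "bil (unit_vec a) (perp (unit_vec b)) = 0"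
    by (simp add: bil_scale_left)
  then show "sin (a - b) = 0" by (simp add: bil_unit_vec_perp)
next
  assume "sin (a - b) = 0"
  then have "unit_vec a = of_real (cos (a - b)) *s unit_vec b"
    using perp_decomp[of "unit_vec b" "unit_vec a"] by (simp add: bil_unit_vec bil_unit_vec_perp)
  then show "\<exists>c. unit_vec a = c *s unit_vec b" by blast
qed

lemma line_unit_vec: "line (unit_vec a) = range (\<lambda>s. s *s perp (unit_vec a))"
  by (simp add: line_perp)

lemma line_unit_vec_eq_iff: "line (unit_vec a) = line (unit_vec b) \<longleftrightarrow> sin (a - b) = 0"
proof
  assume "line (unit_vec a) = line (unit_vec b)"
  moreover have "perp (unit_vec b) \<in> line (unit_vec b)" by (simp add: line_def)
  ultimately have "perp (unit_vec b) \<in> line (unit_vec a)" by simp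
  then show "sin (a - b) = 0" by (simp add: line_def bil_unit_vec_perp)
next
  assume *: "sin (a - b) = 0"
  then obtain c where "unit_vec a = c *s unit_vec b"
    using unit_vec_collinear_iff by blast
  moreover from this have "c \<noteq> 0"
    using bil_unit_vec_self[of a] by (auto simp: bil_def)
  ultimately show "line (unit_vec a) = line (unit_vec b)"
    by (simp add: line_def bil_scale_left)
qed

lemma configuration_angle_config:
  "configuration (angle_config I \<phi> \<mu>) \<longleftrightarrow> finite I \<and> (\<forall>i\<in>I. 0 < \<mu> i) \<and>
    (\<forall>i\<in>I. \<forall>j\<in>I. i \<noteq> j \<longrightarrow> sin (\<phi> i - \<phi> j) \<noteq> 0)"
  by (auto simp: configuration_def angle_config_def unit_vec_collinear_iff[symmetric])

lemma locus_angle_config: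
  "locus (angle_config I \<phi> \<mu>) \<longleftrightarrow> (\<forall>j\<in>I. \<forall>r. odd r \<longrightarrow> r < 2 * \<mu> j \<longrightarrow>
    (\<Sum>i\<in>I - {j}. real (\<mu> i) * cot (\<phi> i - \<phi> j) ^ r) = 0)"
proof -
  have "(\<Sum>i\<in>I - {j}. of_nat (\<mu> i) * (bil (unit_vec (\<phi> i)) (unit_vec (\<phi> j)) /
      bil (unit_vec (\<phi> i)) (perp (unit_vec (\<phi> j)))) ^ r) =
    complex_of_real (\<Sum>i\<in>I - {j}. real (\<mu> i) * cot (\<phi> i - \<phi> j) ^ r)" for j r
    by (simp add: bil_unit_vec bil_unit_vec_perp cot_def)
  then have "(\<Sum>i\<in>I - {j}. of_nat (\<mu> i) * (bil (unit_vec (\<phi> i)) (unit_vec (\<phi> j)) /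
      bil (unit_vec (\<phi> i)) (perp (unit_vec (\<phi> j)))) ^ r) = 0 \<longleftrightarrow>
    (\<Sum>i\<in>I - {j}. real (\<mu> i) * cot (\<phi> i - \<phi> j) ^ r) = 0" for j r
    by (simp only: of_real_eq_0_iff)
  then show ?thesis by (simp add: locus_def angle_config_def)
qed

text \<open>The reflection acts on the other angles as an involution that changes the sign of the
  cotangents.\<close>

lemma sum_cot_mirror:
  fixes \<phi> :: "'i \<Rightarrow> real"
  assumes fin: "finite I" and ne: "\<And>i k. i \<in> I \<Longrightarrow> k \<in> I \<Longrightarrow> i \<noteq> k \<Longrightarrow> sin (\<phi> i - \<phi> k) \<noteq> 0"
    and j: "j \<in> I"
    and mirror: "\<And>i. i \<in> I \<Longrightarrow> \<exists>i'\<in>I. sin (\<phi> i' + \<phi> i - 2 * \<phi> j) = 0 \<and> \<mu> i' = \<mu> i"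
    and r: "odd r"
  shows "(\<Sum>i\<in>I - {j}. real (\<mu> i) * cot (\<phi> i - \<phi> j) ^ r) = 0"
proof -
  have "\<forall>i\<in>I. \<exists>i'. i' \<in> I \<and> sin (\<phi> i' + \<phi> i - 2 * \<phi> j) = 0 \<and> \<mu> i' = \<mu> i"
    using mirror by blast
  from bchoice[OF this] obtain \<sigma> where s: "\<And>i. i \<in> I \<Longrightarrow> \<sigma> i \<in> I"
    "\<And>i. i \<in> I \<Longrightarrow> sin (\<phi> (\<sigma> i) + \<phi> i - 2 * \<phi> j) = 0" "\<And>i. i \<in> I \<Longrightarrow> \<mu> (\<sigma> i) = \<mu> i"
    by blast
  have "sin (\<phi> (\<sigma> j) - \<phi> j) = 0" using s(2)[OF j] by (simp add: algebra_simps)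
  then have sj: "\<sigma> j = j" using ne s(1) j by blast
  have inj: "inj_on \<sigma> I"
  proof (rule inj_onI)
    fix i k assume *: "i \<in> I" "k \<in> I" "\<sigma> i = \<sigma> k"
    have "sin ((\<phi> (\<sigma> i) + \<phi> i - 2 * \<phi> j) - (\<phi> (\<sigma> k) + \<phi> k - 2 * \<phi> j)) = 0"
      by (intro sin_zero_diff s(2) *)
    with * ne[of i k] show "i = k" by auto
  qed
  have "bij_betw \<sigma> I I"
    unfolding bij_betw_def using inj endo_inj_surj[OF fin _ inj] s(1) by blast
  then have bij: "bij_betw \<sigma> (I - {j}) (I - {j})"
    using bij_betw_DiffI[of \<sigma> I I "{j}" "{j}"] sj j by simp
  have cot: "cot (\<phi> (\<sigma> i) - \<phi> j) = - cot (\<phi> i - \<phi> j)" if i: "i \<in> I - {j}" for i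
  proof -
    have "\<sigma> i \<in> I - {j}" using bij i by (auto simp: bij_betw_def)
    then have "sin (\<phi> (\<sigma> i) - \<phi> j) \<noteq> 0" "sin (\<phi> i - \<phi> j) \<noteq> 0" using ne j i by auto
    moreover have "sin ((\<phi> (\<sigma> i) - \<phi> j) + (\<phi> i - \<phi> j)) = 0"
      using s(2)[of i] i by (simp add: algebra_simps)
    ultimately show ?thesis
      unfolding sin_add cot_def by (simp add: field_simps)
  qed
  let ?S = "\<Sum>i\<in>I - {j}. real (\<mu> i) * cot (\<phi> i - \<phi> j) ^ r"
  have "?S = (\<Sum>i\<in>I - {j}. real (\<mu> (\<sigma> i)) * cot (\<phi> (\<sigma> i) - \<phi> j) ^ r)"
    by (rule sum.reindex_bij_betw[OF bij, symmetric])
  also have "\<dots> = (\<Sum>i\<in>I - {j}. - (real (\<mu> i) * cot (\<phi> i - \<phi> j) ^ r))"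
  proof (rule sum.cong[OF refl])
    fix i assume i: "i \<in> I - {j}"
    then show "real (\<mu> (\<sigma> i)) * cot (\<phi> (\<sigma> i) - \<phi> j) ^ r = - (real (\<mu> i) * cot (\<phi> i - \<phi> j) ^ r)"
      using cot[OF i] s(3)[of i] r by simp
  qed
  finally show ?thesis by (simp add: sum_negf)
qed

text \<open>Cancelling \<open>cis (a + b)\<close> leaves 2 cos over 2 i sin, both at a - b. The
  defining equations of the configuration thus become real identities between cotangents.\<close>

lemma cis_cayley:
  assumes "sin (a - b) \<noteq> 0"
  shows "(cis (2 * a) + cis (2 * b)) / (cis (2 * a) - cis (2 * b)) = - \<i> * of_real (cot (a - b))"
proof -
  have "cis (2 * a) = cis (a + b) * cis (a - b)" "cis (2 * b) = cis (a + b) * cis (b - a)"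
    by (simp_all add: cis_mult)
  then have "cis (2 * a) + cis (2 * b) = cis (a + b) * (2 * of_real (cos (a - b)))"
    "cis (2 * a) - cis (2 * b) = cis (a + b) * (2 * \<i> * of_real (sin (a - b)))"
    by (simp_all add: complex_eq_iff algebra_simps sin_diff cos_diff)
  then have "(cis (2 * a) + cis (2 * b)) / (cis (2 * a) - cis (2 * b)) =
      (2 * of_real (cos (a - b))) / (2 * \<i> * of_real (sin (a - b)))"
    by (simp only: mult_divide_mult_cancel_left[OF cis_neq_zero])
  also have "\<dots> = - \<i> * of_real (cot (a - b))"
    using assms by (simp add: cot_def field_simps)
  finally show ?thesis .
qed

lemma cis_two_eq_1_iff: "cis (2 * y) = 1 \<longleftrightarrow> sin y = 0"
proof -
  have "sin y = 0 \<Longrightarrow> sin (2 * y) = 0" by (simp add: sin_double)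
  then show ?thesis by (auto simp: complex_eq_iff cos_double_sin)
qed

lemma sum_root_of_unity_powers:
  assumes "0 < k" "k < q"
  shows "(\<Sum>s\<in>{1..q}. cis (2 * pi * real s / real q) ^ k) = 0"
proof -
  define w where "w = cis (2 * (pi * real k / real q))"
  have "pi * real k / real q < pi" "0 < pi * real k / real q"
    using assms by (simp_all add: field_simps)
  then have "w \<noteq> 1"
    unfolding w_def cis_two_eq_1_iff using sin_gt_zero by (metis less_irrefl)
  moreover have "w ^ q = 1"
  proof -
    have "w ^ q = cis (real q * (2 * (pi * real k / real q)))"
      unfolding w_def by (rule Complex.DeMoivre)
    also have "real q * (2 * (pi * real k / real q)) = 2 * pi * real k"
      using assms by simp
    finally show ?thesis by (simp add: cis_multiple_2pi)
  qed
  moreover have "(\<Sum>s\<in>{1..q}. cis (2 * pi * real s / real q) ^ k) = (\<Sum>s\<in>{1..q}. w ^ s)"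
    unfolding w_def Complex.DeMoivre by (intro sum.cong refl arg_cong[of _ _ cis]) (simp add: field_simps)
  moreover have "(\<Sum>s\<in>{1..q}. w ^ s) = (\<Sum>s<q. w ^ Suc s)"
    by (rule sum.reindex_bij_witness[of _ Suc "\<lambda>s. s - 1"]) auto
  moreover have "\<dots> = w * (\<Sum>s<q. w ^ s)" by (simp add: sum_distrib_left)
  ultimately show ?thesis by (simp add: geometric_sum)
qed

text \<open>The numbers \<open>w s\<close> are the q-th roots of z = \<open>cis (2 * x)\<close>.
  Summing (1 - z) / (1 - w) = 1 + w + ... + w^(q-1) over them gives q, as their power sums of orders
  1 to q - 1 vanish. The Cayley transform turns the resulting sum of 1 / (1 - w) into one of
  cotangents.\<close>

lemma sum_cot_shifts:
  assumes q: "0 < q" and x: "sin x \<noteq> 0"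
  shows "(\<Sum>s\<in>{1..q}. cot ((x + pi * real s) / real q)) = real q * cot x"
proof -
  define w where "w = (\<lambda>s. cis (2 * ((x + pi * real s) / real q)))"
  define z where "z = cis (2 * x)"
  have z: "z \<noteq> 1" using x by (simp add: z_def cis_two_eq_1_iff)
  have w_split: "w s = cis (2 * x / real q) * cis (2 * pi * real s / real q)" for s
    by (simp add: w_def cis_mult add_divide_distrib distrib_left mult_ac)
  have wq: "w s ^ q = z" for s
  proof -
    have "w s ^ q = cis (real q * (2 * ((x + pi * real s) / real q)))"
      unfolding w_def by (rule Complex.DeMoivre)
    also have "real q * (2 * ((x + pi * real s) / real q)) = 2 * x + 2 * pi * real s"
      using q by simp
    also have "cis \<dots> = z * cis (2 * pi * real s)"
      unfolding z_def by (rule cis_mult[symmetric])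
    finally show ?thesis by (simp add: cis_multiple_2pi)
  qed
  have w1: "w s \<noteq> 1" for s using wq[of s] z by auto
  then have sin: "sin ((x + pi * real s) / real q) \<noteq> 0" for s
    unfolding w_def cis_two_eq_1_iff by blast
  have "(\<Sum>s\<in>{1..q}. w s ^ k) = (if k = 0 then of_nat q else 0)" if "k < q" for k
  proof (cases "k = 0")
    case False
    have "(\<Sum>s\<in>{1..q}. w s ^ k) =
        cis (2 * x / real q) ^ k * (\<Sum>s\<in>{1..q}. cis (2 * pi * real s / real q) ^ k)"
      by (simp add: w_split power_mult_distrib sum_distrib_left)
    also have "\<dots> = 0" using sum_root_of_unity_powers[of k q] False that by simp
    finally show ?thesis using False by simp
  qed simp
  then have "(\<Sum>k<q. \<Sum>s\<in>{1..q}. w s ^ k) = (\<Sum>k<q. if k = 0 then of_nat q else 0)"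
    by (intro sum.cong) auto
  also have "\<dots> = of_nat q" using q by simp
  finally have "(\<Sum>s\<in>{1..q}. \<Sum>k<q. w s ^ k) = of_nat q"
    by (subst sum.swap)
  moreover have "(\<Sum>k<q. w s ^ k) = (1 - z) * (1 / (1 - w s))" for s
    using w1[of s] by (simp add: geometric_sum wq field_simps)
  ultimately have "(1 - z) * (\<Sum>s\<in>{1..q}. 1 / (1 - w s)) = of_nat q"
    by (simp add: sum_distrib_left)
  then have inv: "(\<Sum>s\<in>{1..q}. 1 / (1 - w s)) = of_nat q / (1 - z)"
    using z by (simp add: field_simps)
  have cayley: "(u + 1) / (u - 1) = 1 - 2 * (1 / (1 - u))" if "u \<noteq> 1" for u :: complex
    using that by (simp add: field_simps)
  have "(\<Sum>s\<in>{1..q}. (w s + 1) / (w s - 1)) = of_nat q * ((z + 1) / (z - 1))"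
    unfolding cayley[OF w1] cayley[OF z] sum_subtractf sum_distrib_left[symmetric] inv
    by (simp add: algebra_simps)
  moreover have *: "(w s + 1) / (w s - 1) = - \<i> * of_real (cot ((x + pi * real s) / real q))" for s
    using cis_cayley[of "(x + pi * real s) / real q" 0] sin[of s] by (simp add: w_def)
  moreover have "(z + 1) / (z - 1) = - \<i> * of_real (cot x)"
    using cis_cayley[of x 0] x by (simp add: z_def)
  ultimately have "- \<i> * of_real (\<Sum>s\<in>{1..q}. cot ((x + pi * real s) / real q)) =
      - \<i> * of_real (real q * cot x)"
    by (simp only: * of_real_sum of_real_mult of_real_of_nat_eq sum_distrib_left mult.left_commute)
  then show ?thesis
    by (simp only: mult_cancel_left of_real_eq_iff) simp
qed

section \<open>The angles of T_q\<close>

definition T_angle :: "nat \<Rightarrow> ('i \<Rightarrow> real) \<Rightarrow> 'i \<times> nat \<Rightarrow> real"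
  where "T_angle q \<phi> = (\<lambda>(i, s). (\<phi> i + pi * real s) / real q)"

lemma T_config_eq: "T_config q I \<phi> \<mu> = angle_config (I \<times> {1..q}) (T_angle q \<phi>) (\<lambda>(i, s). \<mu> i)"
  by (simp add: T_config_def T_angle_def)

lemma ex_residue:
  assumes "0 < q"
  shows "\<exists>s\<in>{1..q}. \<exists>j. k = int s + int q * j"
proof -
  have "k = int (nat ((k - 1) mod int q + 1)) + int q * ((k - 1) div int q)"
    using assms mult_div_mod_eq[of "int q" "k - 1"] by simp
  moreover have "0 \<le> (k - 1) mod int q" "(k - 1) mod int q < int q" using assms by simp_all
  then have "nat ((k - 1) mod int q + 1) \<in> {1..q}" by (auto simp: le_nat_iff nat_le_iff)
  ultimately show ?thesis by blast
qed

text \<open>Multiplied by q, a coincidence modulo pi makes the original angles agree modulo pi, so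
  both indices are equal; then q divides s - t, which is smaller than q in absolute value.\<close>

lemma T_angle_distinct:
  assumes q: "0 < q" and ne: "\<And>i k. i \<in> I \<Longrightarrow> k \<in> I \<Longrightarrow> i \<noteq> k \<Longrightarrow> sin (\<phi> i - \<phi> k) \<noteq> 0"
    and x: "x \<in> I \<times> {1..q}" and y: "y \<in> I \<times> {1..q}" and "x \<noteq> y"
  shows "sin (T_angle q \<phi> x - T_angle q \<phi> y) \<noteq> 0"
proof
  obtain i s k t where xy: "x = (i, s)" "y = (k, t)" by fastforce
  assume "sin (T_angle q \<phi> x - T_angle q \<phi> y) = 0"
  then obtain j :: int where "T_angle q \<phi> x - T_angle q \<phi> y = of_int j * pi"
    unfolding sin_zero_iff_int2 by blast
  moreover have "T_angle q \<phi> x - T_angle q \<phi> y = (\<phi> i - \<phi> k + pi * (real s - real t)) / real q"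
    by (simp add: xy T_angle_def algebra_simps diff_divide_distrib add_divide_distrib)
  ultimately have "\<phi> i - \<phi> k + pi * (real s - real t) = of_int j * pi * real q"
    using q by (simp add: divide_eq_eq)
  then have j: "\<phi> i - \<phi> k = of_int (int q * j + int t - int s) * pi"
    by (simp add: algebra_simps)
  then have "sin (\<phi> i - \<phi> k) = 0"
    unfolding sin_zero_iff_int2 by blast
  with ne x y have "i = k" by (auto simp: xy)
  with j have "int q * j = int s - int t"
    using of_int_eq_0_iff[of "int q * j + int t - int s", where 'a = real] by auto
  moreover have "\<bar>int s - int t\<bar> < int q" using x y by (auto simp: xy)
  ultimately have "int s - int t = 0"
    using zdvd_not_zless[of "int s - int t" "int q"] zdvd_not_zless[of "int t - int s" "int q"]
    by (metis abs_of_nonneg abs_of_nonpos dvd_imp_le_int dvd_triv_left not_le abs_of_nat)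
  with \<open>i = k\<close> \<open>x \<noteq> y\<close> show False by (simp add: xy)
qed

lemma configuration_T_config:
  assumes "0 < q" and "configuration (angle_config I \<phi> \<mu>)"
  shows "configuration (T_config q I \<phi> \<mu>)"
  using assms T_angle_distinct[of q I \<phi>]
  unfolding T_config_eq configuration_angle_config by auto

lemma T_angle_mirror:
  assumes q: "0 < q" and \<sigma>: "sin (\<phi> i' + \<phi> i - 2 * \<phi> j) = 0"
  shows "\<exists>s'\<in>{1..q}. sin (T_angle q \<phi> (i', s') + T_angle q \<phi> (i, s) - 2 * T_angle q \<phi> (j, t)) = 0"
proof -
  obtain k :: int where k: "\<phi> i' + \<phi> i - 2 * \<phi> j = of_int k * pi"
    using \<sigma> unfolding sin_zero_iff_int2 by blast
  \<comment> \<open>The given symmetry holds up to k pi; s' is chosen to make k + s' + s - 2t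
    divisible by q.\<close>
  obtain s' l where s': "s' \<in> {1..q}" "2 * int t - int s - k = int s' + int q * l"
    using ex_residue[OF q] by blast
  have "T_angle q \<phi> (i', s') + T_angle q \<phi> (i, s) - 2 * T_angle q \<phi> (j, t) =
      ((\<phi> i' + \<phi> i - 2 * \<phi> j) + of_int (int s' + int s - 2 * int t) * pi) / real q"
    using q by (simp add: T_angle_def field_simps)
  also have "\<dots> = of_int (k + int s' + int s - 2 * int t) * pi / real q"
    unfolding k by (simp add: algebra_simps)
  also have "k + int s' + int s - 2 * int t = - (int q * l)" using s'(2) by simp
  also have "of_int \<dots> * pi / real q = of_int (- l) * pi" using q by simp
  finally show ?thesis using s'(1) sin_zero_iff_int2 by blast
qed

text \<open>The angles pi s / q are those of T_q of a single line at angle 0, and they are symmetric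
  about each of their members.\<close>

lemma sum_cot_residues:
  assumes q: "0 < q" and t: "t \<in> {1..q}"
  shows "(\<Sum>s\<in>{1..q} - {t}. cot ((pi * real s - pi * real t) / real q)) = 0"
proof -
  let ?\<phi> = "\<lambda>s. pi * real s / real q"
  have "(\<Sum>s\<in>{1..q} - {t}. real 1 * cot (?\<phi> s - ?\<phi> t) ^ 1) = 0"
  proof (rule sum_cot_mirror[where \<mu> = "\<lambda>_. 1"])
    fix s k assume "s \<in> {1..q}" "k \<in> {1..q}" "s \<noteq> k"
    then show "sin (?\<phi> s - ?\<phi> k) \<noteq> 0"
      using T_angle_distinct[of q "{()}" "\<lambda>_. 0" "((), s)" "((), k)"] q by (simp add: T_angle_def)
  next
    fix s
    show "\<exists>s'\<in>{1..q}. sin (?\<phi> s' + ?\<phi> s - 2 * ?\<phi> t) = 0 \<and> (1::nat) = 1"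
      using T_angle_mirror[of q "\<lambda>_. 0" "()" "()" "()" s t] q by (simp add: T_angle_def)
  qed (use t in auto)
  then show ?thesis by (simp add: diff_divide_distrib)
qed

text \<open>The sum is taken fibre by fibre. A fibre over i \<noteq> j is a full set of shifts; the
  one over j lacks the line itself and cancels by symmetry.\<close>

lemma sum_cot_T_angle:
  assumes q: "0 < q" and I: "finite I" and j: "j \<in> I" and t: "t \<in> {1..q}"
    and ne: "\<And>i. i \<in> I - {j} \<Longrightarrow> sin (\<phi> i - \<phi> j) \<noteq> 0"
  shows "(\<Sum>x\<in>I \<times> {1..q} - {(j, t)}. real (\<mu> (fst x)) * cot (T_angle q \<phi> x - T_angle q \<phi> (j, t)))
    = real q * (\<Sum>i\<in>I - {j}. real (\<mu> i) * cot (\<phi> i - \<phi> j))"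
proof -
  let ?f = "\<lambda>x. real (\<mu> (fst x)) * cot (T_angle q \<phi> x - T_angle q \<phi> (j, t))"
  have split: "I \<times> {1..q} - {(j, t)} = (I - {j}) \<times> {1..q} \<union> {j} \<times> ({1..q} - {t})"
    using j t by auto
  have inner: "(\<Sum>s\<in>{1..q}. ?f (i, s)) = real q * (real (\<mu> i) * cot (\<phi> i - \<phi> j))"
    if i: "i \<in> I - {j}" for i
  proof -
    \<comment> \<open>The shift by pi t stands before the division by q, so it disappears by
      periodicity from the right-hand side of \<open>sum_cot_shifts\<close>.\<close>
    have tpi: "sin (\<phi> i - \<phi> j - pi * real t) = cos (pi * real t) * sin (\<phi> i - \<phi> j)"
      "cos (\<phi> i - \<phi> j - pi * real t) = cos (pi * real t) * cos (\<phi> i - \<phi> j)"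
      "cos (pi * real t) \<noteq> 0"
      by (simp_all add: sin_diff[of _ "pi * real t"] cos_diff[of _ "pi * real t"])
    then have cot: "cot (\<phi> i - \<phi> j - pi * real t) = cot (\<phi> i - \<phi> j)"
      unfolding cot_def by simp
    have "(\<Sum>s\<in>{1..q}. cot ((\<phi> i - \<phi> j - pi * real t + pi * real s) / real q)) =
        real q * cot (\<phi> i - \<phi> j)"
      using sum_cot_shifts[OF q, of "\<phi> i - \<phi> j - pi * real t"] tpi ne[OF i] unfolding cot by simp
    moreover have "T_angle q \<phi> (i, s) - T_angle q \<phi> (j, t) = (\<phi> i - \<phi> j - pi * real t + pi * real s) / real q" for s
      by (simp add: T_angle_def diff_divide_distrib add_divide_distrib)
    ultimately show ?thesis by (simp add: sum_distrib_left[symmetric])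
  qed
  have "(\<Sum>x\<in>{j} \<times> ({1..q} - {t}). ?f x) = (\<Sum>s\<in>{1..q} - {t}. ?f (j, s))"
    by (rule sum.reindex_bij_witness[of _ "\<lambda>s. (j, s)" snd]) auto
  also have "\<dots> = real (\<mu> j) * (\<Sum>s\<in>{1..q} - {t}. cot ((pi * real s - pi * real t) / real q))"
    by (simp add: T_angle_def sum_distrib_left diff_divide_distrib add_divide_distrib)
  finally have own: "(\<Sum>x\<in>{j} \<times> ({1..q} - {t}). ?f x) = 0"
    using sum_cot_residues[OF q t] by simp
  have "(\<Sum>x\<in>(I - {j}) \<times> {1..q}. ?f x) = (\<Sum>i\<in>I - {j}. \<Sum>s\<in>{1..q}. ?f (i, s))"
    by (simp add: sum.cartesian_product case_prod_unfold)
  also have "\<dots> = real q * (\<Sum>i\<in>I - {j}. real (\<mu> i) * cot (\<phi> i - \<phi> j))"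
    unfolding sum_distrib_left by (intro sum.cong refl inner)
  finally show ?thesis
    unfolding split using own I by (subst sum.union_disjoint) auto
qed


section \<open>Lines and the dihedral group\<close>

lemma rotation_nth [simp]:
  "rotation t x $ 1 = of_real (cos t) * x $ 1 - of_real (sin t) * x $ 2"
  "rotation t x $ 2 = of_real (sin t) * x $ 1 + of_real (cos t) * x $ 2"
  by (simp_all add: rotation_def)

text \<open>A line is parametrised by the multiples of \<open>perp\<close> of its normal; on these
  the group acts by arithmetic of angles, with no sign to keep track of.\<close>

lemma rotation_perp_unit_vec: "rotation t (s *s perp (unit_vec a)) = s *s perp (unit_vec (a + t))"
  unfolding vec_eq_iff forall_2 by (simp add: cos_add sin_add algebra_simps)

lemma reflection_perp_unit_vec:
  "reflection (unit_vec b) (s *s perp (unit_vec a)) = s *s perp (unit_vec (2 * b - a))"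
proof -
  have c: "cos (2 * b) = 1 - 2 * sin b * sin b"
    using cos_double_sin[of b] by (simp add: power2_eq_square)
  have c': "cos (2 * b) = 2 * cos b * cos b - 1"
    using cos_double_cos[of b] by (simp add: power2_eq_square)
  have 1: "- sin a - 2 * (sin (b - a)) * cos b = - sin (2 * b - a)"
    unfolding sin_diff[of "2 * b"] c' sin_double sin_diff[of b] by (simp add: algebra_simps)
  have 2: "cos a - 2 * (sin (b - a)) * sin b = cos (2 * b - a)"
    unfolding cos_diff[of "2 * b"] c sin_double sin_diff[of b] by (simp add: algebra_simps)
  have "reflection (unit_vec b) (s *s perp (unit_vec a)) $ 1 =
      s * of_real (- sin a - 2 * (sin (b - a)) * cos b)"
    "reflection (unit_vec b) (s *s perp (unit_vec a)) $ 2 =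
      s * of_real (cos a - 2 * (sin (b - a)) * sin b)"
    by (simp_all add: reflection_def bil_scale_right bil_unit_vec_perp algebra_simps)
  then show ?thesis
    unfolding vec_eq_iff forall_2 1 2 by simp
qed

lemma rotation_line: "rotation t ` line (unit_vec a) = line (unit_vec (a + t))"
  unfolding line_unit_vec image_image rotation_perp_unit_vec ..

lemma reflection_line: "reflection (unit_vec b) ` line (unit_vec a) = line (unit_vec (2 * b - a))"
  unfolding line_unit_vec image_image reflection_perp_unit_vec ..

text \<open>A reflection negates its normal, and any vector negated by the reflection in
  \<open>b\<close> is a multiple of \<open>b\<close>.\<close>

lemma reflection_eq_imp_line_eq:
  assumes "bil a a \<noteq> 0" "bil b b \<noteq> 0" "reflection a = reflection b"
  shows "line a = line b"
proof -
  have "reflection a a = - a" using assms(1) unfolding vec_eq_iff forall_2 by (simp add: reflection_def)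
  then have "a - (2 * bil b a / bil b b) *s b = - a" using assms(3) by (simp add: reflection_def)
  then have "2 *s a = (2 * bil b a / bil b b) *s b"
    unfolding vec_eq_iff forall_2 by (simp add: algebra_simps)
  then have a: "a = (bil b a / bil b b) *s b"
    using assms(2) unfolding vec_eq_iff forall_2 by (auto simp: field_simps)
  then have "bil b a \<noteq> 0" using assms(1) by (auto simp: bil_def)
  then have "bil (c *s b) x = 0 \<longleftrightarrow> bil b x = 0" if "c = bil b a / bil b b" for x c
    using assms(2) that by (simp add: bil_scale_left)
  with a show ?thesis unfolding line_def by metis
qed

text \<open>A rotation commutes with \<open>perp\<close>, whereas the reflection negates
  \<open>a\<close> and fixes \<open>perp a\<close>.\<close>

lemma reflection_neq_rotation:
  assumes "bil a a \<noteq> 0"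
  shows "reflection a \<noteq> rotation t"
proof
  assume eq: "reflection a = rotation t"
  have "reflection a a = - a" using assms unfolding vec_eq_iff forall_2 by (simp add: reflection_def)
  moreover have "reflection a (perp a) = perp a" by (simp add: reflection_def)
  moreover have "rotation t (perp a) = perp (rotation t a)"
    unfolding vec_eq_iff forall_2 by (simp add: algebra_simps)
  ultimately have "perp a = perp (- a)" using eq by simp
  then have "a = 0" unfolding vec_eq_iff forall_2 by simp
  with assms show False by (simp add: bil_def)
qed

lemma rotation_eq_iff: "rotation s = rotation t \<longleftrightarrow> cis s = cis t"
proof
  assume "rotation s = rotation t"
  then have "rotation s (unit_vec 0) = rotation t (unit_vec 0)" by simp
  then show "cis s = cis t"
    unfolding vec_eq_iff forall_2 by (simp add: complex_eq_iff)
next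
  assume "cis s = cis t"
  then have "cos s = cos t" "sin s = sin t" by (simp_all add: complex_eq_iff)
  then show "rotation s = rotation t" by (simp add: rotation_def fun_eq_iff)
qed

lemma sin_pi_div_eq_0_iff:
  assumes "0 < k"
  shows "sin (pi * of_int j / real k) = 0 \<longleftrightarrow> int k dvd j"
proof
  assume "sin (pi * of_int j / real k) = 0"
  then obtain i :: int where "pi * of_int j / real k = of_int i * pi"
    unfolding sin_zero_iff_int2 by blast
  then have "real_of_int j = of_int (int k * i)" using assms by (simp add: field_simps)
  then show "int k dvd j" by (metis dvd_triv_left of_int_eq_iff)
next
  assume "int k dvd j"
  then obtain i where "j = int k * i" by blast
  then have "pi * of_int j / real k = of_int i * pi" using assms by simp
  then show "sin (pi * of_int j / real k) = 0" unfolding sin_zero_iff_int2 by blast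
qed

lemma dvd_diff_less_imp_eq:
  assumes "int k dvd int i - int j" "i < k" "j < k"
  shows "i = j"
proof -
  have "int i mod int k = int j mod int k" using assms(1) by (simp add: mod_eq_dvd_iff)
  with assms(2,3) show ?thesis by simp
qed

lemma card_dihedral:
  assumes k: "0 < k"
  shows "card (dihedral k \<theta>) = 2 * k"
proof -
  let ?r = "\<lambda>j. rotation (2 * pi * real j / real k)"
  let ?s = "\<lambda>j. reflection (unit_vec (\<theta> + pi * real j / real k))"
  have "inj_on ?r {..<k}"
  proof (rule inj_onI)
    fix i j assume ij: "i \<in> {..<k}" "j \<in> {..<k}" and "?r i = ?r j"
    then have "cis (2 * pi * real i / real k) / cis (2 * pi * real j / real k) = 1"
      by (simp add: rotation_eq_iff)
    then have "cis (2 * (pi * of_int (int i - int j) / real k)) = 1"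
      by (simp add: cis_divide diff_divide_distrib algebra_simps)
    then have "int k dvd int i - int j"
      unfolding cis_two_eq_1_iff sin_pi_div_eq_0_iff[OF k] .
    with ij show "i = j" by (auto intro: dvd_diff_less_imp_eq)
  qed
  moreover have "inj_on ?s {..<k}"
  proof (rule inj_onI)
    fix i j assume ij: "i \<in> {..<k}" "j \<in> {..<k}" and eq: "?s i = ?s j"
    have "line (unit_vec (\<theta> + pi * real i / real k)) = line (unit_vec (\<theta> + pi * real j / real k))"
      by (rule reflection_eq_imp_line_eq[OF _ _ eq]) simp_all
    then have "sin (pi * of_int (int i - int j) / real k) = 0"
      unfolding line_unit_vec_eq_iff by (simp add: diff_divide_distrib algebra_simps)
    then have "int k dvd int i - int j"
      unfolding sin_pi_div_eq_0_iff[OF k] .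
    with ij show "i = j" by (auto intro: dvd_diff_less_imp_eq)
  qed
  moreover have "?r ` {..<k} \<inter> ?s ` {..<k} = {}"
    using reflection_neq_rotation[of "unit_vec a" for a] by (auto dest: sym)
  ultimately show ?thesis
    unfolding dihedral_def by (simp add: card_Un_disjoint card_image)
qed

lemma mirrors_dihedral:
  "mirrors (dihedral k \<theta>) = (\<lambda>j. line (unit_vec (\<theta> + pi * real j / real k))) ` {..<k}"
proof (intro equalityI subsetI)
  fix L assume "L \<in> mirrors (dihedral k \<theta>)"
  then obtain a where a: "L = line a" "bil a a \<noteq> 0" "reflection a \<in> dihedral k \<theta>"
    by (auto simp: mirrors_def)
  then obtain j where j: "j < k" "reflection a = reflection (unit_vec (\<theta> + pi * real j / real k))"
    using reflection_neq_rotation[OF a(2)] by (auto simp: dihedral_def)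
  have "line a = line (unit_vec (\<theta> + pi * real j / real k))"
    by (rule reflection_eq_imp_line_eq[OF a(2) _ j(2)]) simp
  with a(1) j(1) show "L \<in> (\<lambda>j. line (unit_vec (\<theta> + pi * real j / real k))) ` {..<k}" by blast
next
  fix L assume "L \<in> (\<lambda>j. line (unit_vec (\<theta> + pi * real j / real k))) ` {..<k}"
  then obtain j where "j < k" "L = line (unit_vec (\<theta> + pi * real j / real k))" by auto
  then show "L \<in> mirrors (dihedral k \<theta>)"
    unfolding mirrors_def dihedral_def
    by (intro CollectI exI[of _ "unit_vec (\<theta> + pi * real j / real k)"]) auto
qed

text \<open>The fibre over \<open>a\<close> of multiplication by q on angles modulo pi. Arrangements
  of T_q, mirrors and orbits are all unions of such fibres and can be compared through the angles
  \<open>a\<close>.\<close>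

definition lines_over :: "nat \<Rightarrow> real \<Rightarrow> (complex^2) set set"
  where "lines_over q a = {line (unit_vec \<psi>) | \<psi>. sin (real q * \<psi> - a) = 0}"

lemma line_in_lines_over_iff: "line (unit_vec \<psi>) \<in> lines_over q a \<longleftrightarrow> sin (real q * \<psi> - a) = 0"
proof
  assume "line (unit_vec \<psi>) \<in> lines_over q a"
  then obtain \<eta> where "sin (\<psi> - \<eta>) = 0" "sin (real q * \<eta> - a) = 0"
    by (auto simp: lines_over_def line_unit_vec_eq_iff)
  then have "sin (real q * (\<psi> - \<eta>) + (real q * \<eta> - a)) = 0"
    by (intro sin_zero_add sin_zero_of_nat_mult)
  then show "sin (real q * \<psi> - a) = 0" by (simp add: algebra_simps)
qed (auto simp: lines_over_def)

lemma lines_over_cong: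
  assumes "sin (a - b) = 0"
  shows "lines_over q a = lines_over q b"
proof -
  have "sin (x - a) = 0 \<longleftrightarrow> sin (x - b) = 0" for x
    using sin_zero_add[OF _ assms, of "x - a"] sin_zero_diff[OF _ assms, of "x - b"] by auto
  then show ?thesis by (simp add: lines_over_def)
qed

lemma lines_over_disjoint:
  assumes "sin (a - b) \<noteq> 0"
  shows "lines_over q a \<inter> lines_over q b = {}"
proof -
  have False if "sin (x - a) = 0" "sin (x - b) = 0" for x
    using sin_zero_diff[OF that(2,1)] assms by simp
  then show ?thesis
    using line_in_lines_over_iff by (fastforce simp: lines_over_def)
qed

lemma line_in_lines_over_div: "0 < q \<Longrightarrow> line (unit_vec (a / real q)) \<in> lines_over q a"
  by (simp add: line_in_lines_over_iff)

text \<open>\<open>J\<close> need only meet every residue class modulo q: T_q runs through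
  \<open>{1..q}\<close>, while in a dihedral orbit each class is met twice.\<close>

lemma lines_over_residues:
  assumes q: "0 < q" and J: "\<And>k::int. \<exists>j\<in>J. int q dvd k - int j"
  shows "(\<lambda>j. line (unit_vec (\<psi> + pi * real j / real q))) ` J = lines_over q (real q * \<psi>)"
proof (intro equalityI subsetI)
  fix L assume "L \<in> (\<lambda>j. line (unit_vec (\<psi> + pi * real j / real q))) ` J"
  then show "L \<in> lines_over q (real q * \<psi>)"
    using q by (auto simp: line_in_lines_over_iff algebra_simps sin_npi2)
next
  fix L assume "L \<in> lines_over q (real q * \<psi>)"
  then obtain \<eta> where L: "L = line (unit_vec \<eta>)" "sin (real q * \<eta> - real q * \<psi>) = 0"
    by (auto simp: lines_over_def)
  then obtain k :: int where "real q * \<eta> - real q * \<psi> = of_int k * pi"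
    unfolding sin_zero_iff_int2 by blast
  then have k: "\<eta> - \<psi> = pi * of_int k / real q" using q by (simp add: field_simps)
  obtain j where j: "j \<in> J" "int q dvd k - int j" using J by blast
  have "\<eta> - (\<psi> + pi * real j / real q) = pi * of_int (k - int j) / real q"
    using k by (simp add: diff_divide_distrib algebra_simps)
  then have "L = line (unit_vec (\<psi> + pi * real j / real q))"
    unfolding L line_unit_vec_eq_iff using j(2) by (simp add: sin_pi_div_eq_0_iff[OF q] del: of_int_diff)
  with j(1) show "L \<in> (\<lambda>j. line (unit_vec (\<psi> + pi * real j / real q))) ` J" by blast
qed

lemma ex_residue_lessThan:
  assumes "0 < q" "q \<le> N"
  shows "\<exists>j\<in>{..<N}. int q dvd k - int j"
proof (intro bexI)
  show "int q dvd k - int (nat (k mod int q))" using assms(1) by simp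
  show "nat (k mod int q) \<in> {..<N}"
  proof -
    have "k mod int q < int q" using assms(1) by simp
    also have "\<dots> \<le> int N" using assms(2) by simp
    finally show ?thesis using assms(1) by (simp add: nat_less_iff)
  qed
qed

lemma arrangement_lines_T_config:
  assumes "0 < q"
  shows "arrangement_lines (T_config q I \<phi> \<mu>) = (\<Union>i\<in>I. lines_over q (\<phi> i))"
proof -
  have J: "\<exists>j\<in>{1..q}. int q dvd k - int j" for k
  proof -
    obtain s j where "s \<in> {1..q}" "k = int s + int q * j" using ex_residue[OF assms] by blast
    then have "k - int s = int q * j" by simp
    with \<open>s \<in> {1..q}\<close> show ?thesis by (metis dvd_triv_left)
  qed
  have "arrangement_lines (T_config q I \<phi> \<mu>) =
    (\<Union>i\<in>I. (\<lambda>j. line (unit_vec (\<phi> i / real q + pi * real j / real q))) ` {1..q})"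
    by (auto simp: arrangement_lines_def T_config_def angle_config_def add_divide_distrib image_iff
          simp del: atLeastAtMost_iff) blast
  also have "\<dots> = (\<Union>i\<in>I. lines_over q (\<phi> i))"
    using lines_over_residues[OF assms J] assms by simp
  finally show ?thesis .
qed

text \<open>Rotations move \<open>\<psi>\<close> by multiples of pi / q and reflections send it to
  \<open>2 * \<theta> - \<psi>\<close> up to such multiples, which gives one fibre each.\<close>

lemma line_orbit_dihedral:
  assumes q: "0 < q"
  shows "line_orbit (dihedral (2 * q) \<theta>) (line (unit_vec \<psi>)) =
    lines_over q (real q * \<psi>) \<union> lines_over q (2 * (real q * \<theta>) - real q * \<psi>)"
proof -
  have "\<psi> + 2 * pi * real j / real (2 * q) = \<psi> + pi * real j / real q"
    "2 * (\<theta> + pi * real j / real (2 * q)) - \<psi> = (2 * \<theta> - \<psi>) + pi * real j / real q" for j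
    using q by (simp_all add: field_simps)
  then have "line_orbit (dihedral (2 * q) \<theta>) (line (unit_vec \<psi>)) =
    (\<lambda>j. line (unit_vec (\<psi> + pi * real j / real q))) ` {..<2 * q} \<union>
    (\<lambda>j. line (unit_vec ((2 * \<theta> - \<psi>) + pi * real j / real q))) ` {..<2 * q}"
    unfolding line_orbit_def dihedral_def image_Un image_image rotation_line reflection_line
    by (simp only:)
  moreover have "\<exists>j\<in>{..<2 * q}. int q dvd k - int j" for k
    by (rule ex_residue_lessThan) (use q in auto)
  ultimately show ?thesis
    by (simp add: lines_over_residues[OF q] right_diff_distrib mult.left_commute)
qed

text \<open>Mirrors are spaced by pi / (2q) and so form one fibre for 2q; the double angle formula
  splits it into two fibres for q.\<close>

lemma mirrors_dihedral_lines_over: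
  assumes q: "0 < q"
  shows "mirrors (dihedral (2 * q) \<theta>) = lines_over q (real q * \<theta>) \<union> lines_over q (real q * \<theta> + pi / 2)"
proof -
  have "\<exists>j\<in>{..<2 * q}. int (2 * q) dvd k - int j" for k
    by (rule ex_residue_lessThan) (use q in auto)
  then have "mirrors (dihedral (2 * q) \<theta>) = lines_over (2 * q) (real (2 * q) * \<theta>)"
    unfolding mirrors_dihedral using q by (intro lines_over_residues) auto
  also have "\<dots> = lines_over q (real q * \<theta>) \<union> lines_over q (real q * \<theta> + pi / 2)"
  proof -
    have "sin (real (2 * q) * \<psi> - real (2 * q) * \<theta>) = 0 \<longleftrightarrow>
      sin (real q * \<psi> - real q * \<theta>) = 0 \<or> sin (real q * \<psi> - (real q * \<theta> + pi / 2)) = 0" for \<psi>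
    proof -
      let ?y = "real q * \<psi> - real q * \<theta>"
      have "sin (real (2 * q) * \<psi> - real (2 * q) * \<theta>) = 2 * sin ?y * cos ?y"
        using sin_double[of ?y] by (simp add: algebra_simps)
      moreover have "sin (real q * \<psi> - (real q * \<theta> + pi / 2)) = - cos ?y"
        using sin_diff[of ?y "pi / 2"] by (simp add: algebra_simps)
      ultimately show ?thesis by simp
    qed
    then show ?thesis unfolding lines_over_def by blast
  qed
  finally show ?thesis .
qed

section \<open>The configurations A_(m, mt, 1^n) and their images under T_q\<close>

lemma is_A_anglesD:
  assumes "is_A_angles m mt n \<phi>"
  shows "configuration (angle_config {0..n+1} \<phi> (A_mult m mt n))"
    and "cos (\<phi> 0 - \<phi> (n + 1)) = 0"
    and "i \<in> {0..n+1} \<Longrightarrow>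
      \<exists>i'\<in>{0..n+1}. sin (\<phi> i' + \<phi> i - 2 * \<phi> 0) = 0 \<and> A_mult m mt n i' = A_mult m mt n i"
    and "j \<in> {1..n} \<Longrightarrow>
      (\<Sum>i\<in>{0..n+1} - {j}. real (A_mult m mt n i) * cot (\<phi> i - \<phi> j)) = 0"
proof -
  let ?\<mu> = "A_mult m mt n" and ?C = "angle_config {0..n+1} \<phi> (A_mult m mt n)"
  note A = assms[unfolded is_A_angles_def Let_def]
  show conf: "configuration ?C" using A by blast
  have "bil (unit_vec (\<phi> 0)) (unit_vec (\<phi> (n + 1))) = 0"
    using A by (simp add: angle_config_def)
  then show "cos (\<phi> 0 - \<phi> (n + 1)) = 0"
    unfolding bil_unit_vec of_real_eq_0_iff .
  show "\<exists>i'\<in>{0..n+1}. sin (\<phi> i' + \<phi> i - 2 * \<phi> 0) = 0 \<and> ?\<mu> i' = ?\<mu> i" if i: "i \<in> {0..n+1}"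
  proof -
    let ?L = "line (unit_vec (2 * \<phi> 0 - \<phi> i))"
    have sym: "(\<lambda>(L, k). (reflection (unit_vec (\<phi> 0)) ` L, k)) ` arrangement ?C = arrangement ?C"
      using A by (simp add: symmetric_under_def angle_config_def)
    have "(line (unit_vec (\<phi> i)), ?\<mu> i) \<in> arrangement ?C"
      using i by (auto simp: arrangement_def angle_config_def)
    then have "(?L, ?\<mu> i) \<in> (\<lambda>(L, k). (reflection (unit_vec (\<phi> 0)) ` L, k)) ` arrangement ?C"
      by (intro image_eqI[where x = "(line (unit_vec (\<phi> i)), ?\<mu> i)"]) (auto simp: reflection_line)
    then have "(?L, ?\<mu> i) \<in> arrangement ?C" unfolding sym .
    then obtain i' where "i' \<in> {0..n+1}" "line (unit_vec (\<phi> i')) = ?L" "?\<mu> i' = ?\<mu> i"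
      by (auto simp: arrangement_def angle_config_def)
    then show ?thesis
      unfolding line_unit_vec_eq_iff by (intro bexI[of _ i']) (simp_all add: algebra_simps)
  qed
  show "(\<Sum>i\<in>{0..n+1} - {j}. real (?\<mu> i) * cot (\<phi> i - \<phi> j)) = 0" if j: "j \<in> {1..n}"
  proof -
    have ne: "sin (\<phi> i - \<phi> j) \<noteq> 0" if "i \<in> {0..n+1} - {j}" for i
      using conf j that unfolding configuration_angle_config by auto
    have "(\<Sum>i\<in>{0..n+1} - {j}. of_nat (?\<mu> i) * (cis (2 * \<phi> i) + cis (2 * \<phi> j)) /
        (cis (2 * \<phi> i) - cis (2 * \<phi> j))) = 0"
      using A j by (simp add: angle_config_def)
    moreover have "of_nat (?\<mu> i) * (cis (2 * \<phi> i) + cis (2 * \<phi> j)) / (cis (2 * \<phi> i) - cis (2 * \<phi> j)) =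
        - \<i> * of_real (real (?\<mu> i) * cot (\<phi> i - \<phi> j))" if "i \<in> {0..n+1} - {j}" for i
      unfolding times_divide_eq_right[symmetric] cis_cayley[OF ne[OF that]] by simp
    ultimately have "(\<Sum>i\<in>{0..n+1} - {j}. - \<i> * of_real (real (?\<mu> i) * cot (\<phi> i - \<phi> j))) = 0"
      by (metis (no_types, lifting) sum.cong)
    then have "- \<i> * of_real (\<Sum>i\<in>{0..n+1} - {j}. real (?\<mu> i) * cot (\<phi> i - \<phi> j)) = 0"
      unfolding of_real_sum sum_distrib_left .
    then show ?thesis
      unfolding mult_eq_0_iff of_real_eq_0_iff by simp
  qed
qed

lemma locus_T_config_A:
  assumes q: "0 < q" and A: "is_A_angles m mt n \<phi>"
  shows "locus (T_config q {0..n+1} \<phi> (A_mult m mt n))"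
  unfolding T_config_eq locus_angle_config
proof (intro ballI allI impI)
  fix x r assume x: "x \<in> {0..n+1} \<times> {1..q}" and r: "odd r"
    and rm: "r < 2 * (case x of (i, s) \<Rightarrow> A_mult m mt n i)"
  obtain j t where jt: "x = (j, t)" "j \<in> {0..n+1}" "t \<in> {1..q}" using x by auto
  note D = is_A_anglesD[OF A]
  have ne: "sin (\<phi> i - \<phi> k) \<noteq> 0" if "i \<in> {0..n+1}" "k \<in> {0..n+1}" "i \<noteq> k" for i k
    using D(1) that unfolding configuration_angle_config by blast
  show "(\<Sum>i\<in>{0..n+1} \<times> {1..q} - {x}. real (case i of (i, s) \<Rightarrow> A_mult m mt n i) *
      cot (T_angle q \<phi> i - T_angle q \<phi> x) ^ r) = 0"
  proof (cases "j \<in> {1..n}")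
    case True
    \<comment> \<open>Multiplicity one leaves only the first power, for which the condition is the
      given sum.\<close>
    with rm r jt have "r = 1" by (auto simp: A_mult_def elim: oddE)
    then show ?thesis
      using sum_cot_T_angle[OF q _ jt(2,3), of \<phi> "A_mult m mt n"] ne jt(2) D(4)[OF True]
      by (simp add: jt(1) case_prod_unfold)
  next
    case False
    then have "j = 0 \<or> j = n + 1" using jt(2) by auto
    \<comment> \<open>As \<alpha>_0 and \<alpha>_(n+1) are orthogonal, the symmetry about either is
      also one about the other.\<close>
    then have j2: "sin (2 * \<phi> 0 - 2 * \<phi> j) = 0"
      using sin_double[of "\<phi> 0 - \<phi> j"] D(2) by (auto simp: algebra_simps)
    show ?thesis
    proof (rule sum_cot_mirror[OF _ T_angle_distinct[OF q ne] x _ r])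
      fix y assume y: "y \<in> {0..n+1} \<times> {1..q}"
      then obtain i s where yis: "y = (i, s)" "i \<in> {0..n+1}" by auto
      obtain i' where i': "i' \<in> {0..n+1}" "sin (\<phi> i' + \<phi> i - 2 * \<phi> 0) = 0"
        "A_mult m mt n i' = A_mult m mt n i"
        using D(3)[OF yis(2)] by blast
      have "sin (\<phi> i' + \<phi> i - 2 * \<phi> j) = 0"
        using sin_zero_add[OF i'(2) j2] by (simp add: algebra_simps)
      from T_angle_mirror[of q \<phi> i' i j s t, OF q this] obtain s' where
        "s' \<in> {1..q}" "sin (T_angle q \<phi> (i', s') + T_angle q \<phi> (i, s) - 2 * T_angle q \<phi> (j, t)) = 0"
        by blast
      with i' show "\<exists>y'\<in>{0..n+1} \<times> {1..q}. sin (T_angle q \<phi> y' + T_angle q \<phi> y - 2 * T_angle q \<phi> x) = 0 \<and>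
          (case y' of (i, s) \<Rightarrow> A_mult m mt n i) = (case y of (i, s) \<Rightarrow> A_mult m mt n i)"
        by (intro bexI[of _ "(i', s')"]) (simp_all add: yis jt(1))
    qed simp_all
  qed
qed

lemma card_image_two_to_one:
  assumes "finite S" and "\<And>i. i \<in> S \<Longrightarrow> card {k \<in> S. f k = f i} = 2"
  shows "card S = 2 * card (f ` S)"
proof -
  have "card S = (\<Sum>B\<in>f ` S. \<Sum>k\<in>{k \<in> S. f k = B}. 1)"
    using sum.image_gen[OF assms(1), of "\<lambda>_. 1::nat" f] by simp
  also have "\<dots> = (\<Sum>B\<in>f ` S. 2)"
    using assms(2) by (intro sum.cong refl) auto
  finally show ?thesis by simp
qed

theorem corollary3p10:
  fixes m mt n q :: nat and \<phi> :: "nat \<Rightarrow> real"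
  assumes "1 \<le> m" and "1 \<le> mt" and "0 < n" and "even n" and "1 \<le> q"
    and "is_A_angles m mt n \<phi>"
  shows "let C = T_config q {0..n+1} \<phi> (A_mult m mt n) in
    configuration C \<and> admits_BA C \<and>
    (\<exists>\<theta> \<O>. let G = dihedral (2 * q) \<theta> in
       card G = 4 * q \<and>
       card \<O> = n div 2 \<and>
       (\<forall>B\<in>\<O>. \<exists>L\<in>arrangement_lines C. B = line_orbit G L) \<and>
       mirrors G \<inter> \<Union>\<O> = {} \<and>
       arrangement_lines C = mirrors G \<union> \<Union>\<O> \<and>
       (\<forall>(L, k)\<in>arrangement C. L \<in> \<Union>\<O> \<longrightarrow> k = 1))"
proof -
  let ?I = "{0..n+1}"
  define C where "C = T_config q ?I \<phi> (A_mult m mt n)"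
  \<comment> \<open>Makes \<open>q * \<theta>\<close> the angle of \<alpha>_0, so that the mirrors
    are the fibres over \<alpha>_0 and \<alpha>_(n+1).\<close>
  define \<theta> where "\<theta> = \<phi> 0 / real q"
  define G where "G = dihedral (2 * q) \<theta>"
  define F where "F = (\<lambda>i. lines_over q (\<phi> i))"
  have q: "0 < q" using assms(5) by simp
  note D = is_A_anglesD[OF assms(6)]
  have ne: "sin (\<phi> i - \<phi> k) \<noteq> 0" if "i \<in> ?I" "k \<in> ?I" "i \<noteq> k" for i k
    using D(1) that unfolding configuration_angle_config by blast
  have conf: "configuration C"
    unfolding C_def by (rule configuration_T_config[OF q D(1)])
  have BA: "admits_BA C"
    using locus_admits_BA[OF conf] locus_T_config_A[OF q assms(6)] by (simp add: C_def)
  have q\<theta>: "real q * \<theta> = \<phi> 0" using q by (simp add: \<theta>_def)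
  have lines: "arrangement_lines C = \<Union>(F ` ?I)"
    unfolding C_def F_def by (rule arrangement_lines_T_config[OF q])
  have disj: "F i \<inter> F k = {}" if "i \<in> ?I" "k \<in> ?I" "i \<noteq> k" for i k
    unfolding F_def using ne[OF that] by (rule lines_over_disjoint)
  have nonempty: "F i \<noteq> {}" for i
    using line_in_lines_over_div[OF q] by (auto simp: F_def)
  have last: "sin (\<phi> (n + 1) - (\<phi> 0 + pi / 2)) = 0"
    using D(2) sin_diff[of "\<phi> (n + 1) - \<phi> 0" "pi / 2"] cos_minus[of "\<phi> 0 - \<phi> (n + 1)"]
    by (simp add: algebra_simps)
  have mirrors: "mirrors G = F 0 \<union> F (n + 1)"
    unfolding G_def mirrors_dihedral_lines_over[OF q] q\<theta> F_def lines_over_cong[OF last] ..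
  have last2: "sin (2 * \<phi> (n + 1) - 2 * \<phi> 0) = 0"
    using sin_double[of "\<phi> (n + 1) - \<phi> 0"] D(2) cos_minus[of "\<phi> 0 - \<phi> (n + 1)"] by (simp add: algebra_simps)
  have "\<forall>i\<in>?I. \<exists>i'. i' \<in> ?I \<and> sin (\<phi> i' + \<phi> i - 2 * \<phi> 0) = 0"
    using D(3) by blast
  from bchoice[OF this] obtain \<sigma> where \<sigma>: "\<And>i. i \<in> ?I \<Longrightarrow> \<sigma> i \<in> ?I"
    "\<And>i. i \<in> ?I \<Longrightarrow> sin (\<phi> (\<sigma> i) + \<phi> i - 2 * \<phi> 0) = 0" by blast
  \<comment> \<open>Angles are distinct modulo pi, so mirror images of indices are unique; this
    makes \<sigma> an involution and yields its fixed points.\<close>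
  have \<sigma>_eqI: "\<sigma> i = k" if "i \<in> ?I" "k \<in> ?I" "sin (\<phi> k + \<phi> i - 2 * \<phi> 0) = 0" for i k
  proof (rule ccontr)
    assume "\<sigma> i \<noteq> k"
    moreover have "sin ((\<phi> (\<sigma> i) + \<phi> i - 2 * \<phi> 0) - (\<phi> k + \<phi> i - 2 * \<phi> 0)) = 0"
      by (intro sin_zero_diff \<sigma>(2) that)
    ultimately show False using ne[OF \<sigma>(1)[OF that(1)] that(2)] by simp
  qed
  have \<sigma>\<sigma>: "\<sigma> (\<sigma> i) = i" if "i \<in> ?I" for i
    using \<sigma>[OF that] that by (intro \<sigma>_eqI) (auto simp: add.commute)
  have fixed: "\<sigma> 0 = 0" "\<sigma> (n + 1) = n + 1"
    by (rule \<sigma>_eqI; use last2 in simp)+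
  have \<sigma>_in: "\<sigma> i \<in> {1..n}" if i: "i \<in> {1..n}" for i
  proof -
    have "\<sigma> i \<in> ?I" "\<sigma> (\<sigma> i) = i" using \<sigma>(1) \<sigma>\<sigma> i by simp_all
    then show ?thesis using fixed i by (cases "\<sigma> i = 0"; cases "\<sigma> i = n + 1") auto
  qed
  \<comment> \<open>The angle of a fixed index is congruent modulo pi to \<open>\<phi> 0\<close> or
    to \<open>\<phi> 0 + pi / 2\<close>, and those classes belong to 0 and n + 1.\<close>
  have \<sigma>_neq: "\<sigma> i \<noteq> i" if i: "i \<in> {1..n}" for i
  proof
    assume "\<sigma> i = i"
    with \<sigma>(2)[of i] i have "sin (2 * (\<phi> i - \<phi> 0)) = 0" by (simp add: algebra_simps)
    moreover have "sin (\<phi> i - \<phi> 0) \<noteq> 0" using ne[of i 0] i by simp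
    ultimately have "sin (\<phi> i - (\<phi> 0 + pi / 2)) = 0"
      unfolding sin_double using sin_diff[of "\<phi> i - \<phi> 0" "pi / 2"] by (simp add: algebra_simps)
    from sin_zero_diff[OF this last] have "sin (\<phi> i - \<phi> (n + 1)) = 0" by simp
    with ne[of i "n + 1"] i show False by simp
  qed
  define orb where "orb = (\<lambda>i. F i \<union> F (\<sigma> i))"
  have orb: "orb i = line_orbit G (line (unit_vec (\<phi> i / real q)))" if i: "i \<in> {1..n}" for i
  proof -
    have "sin (\<phi> (\<sigma> i) - (2 * \<phi> 0 - \<phi> i)) = 0"
      using \<sigma>(2)[of i] i by (simp add: algebra_simps)
    then show ?thesis
      using q unfolding orb_def F_def G_def line_orbit_dihedral[OF q] q\<theta>
      by (simp add: lines_over_cong)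
  qed
  \<comment> \<open>Fibres are nonempty, and disjoint for different indices, so an orbit determines
    its pair of indices; the count n / 2 is that of the pairs.\<close>
  have fibre: "{k \<in> {1..n}. orb k = orb i} = {i, \<sigma> i}" if i: "i \<in> {1..n}" for i
  proof (intro equalityI subsetI)
    fix k assume k: "k \<in> {k \<in> {1..n}. orb k = orb i}"
    then have "F k \<subseteq> F i \<union> F (\<sigma> i)" by (auto simp: orb_def)
    with nonempty[of k] have "F k \<inter> F i \<noteq> {} \<or> F k \<inter> F (\<sigma> i) \<noteq> {}" by blast
    then show "k \<in> {i, \<sigma> i}"
      using disj[of k i] disj[of k "\<sigma> i"] \<sigma>_in[OF i] k i by auto
  next
    fix k assume "k \<in> {i, \<sigma> i}"
    then show "k \<in> {k \<in> {1..n}. orb k = orb i}"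
      using \<sigma>_in[OF i] \<sigma>\<sigma>[of i] i by (auto simp: orb_def)
  qed
  define \<O> where "\<O> = orb ` {1..n}"
  have "card {k \<in> {1..n}. orb k = orb i} = 2" if "i \<in> {1..n}" for i
    unfolding fibre[OF that] using \<sigma>_neq[OF that] by auto
  from card_image_two_to_one[OF _ this] have card: "card \<O> = n div 2"
    by (simp add: \<O>_def)
  have Un: "\<Union>\<O> = \<Union>(F ` {1..n})"
    using \<sigma>_in by (auto simp: \<O>_def orb_def simp del: atLeastAtMost_iff)
  have orbits: "\<exists>L\<in>arrangement_lines C. B = line_orbit G L" if "B \<in> \<O>" for B
  proof -
    obtain i where i: "i \<in> {1..n}" "B = orb i" using \<open>B \<in> \<O>\<close> by (auto simp: \<O>_def)
    have "line (unit_vec (\<phi> i / real q)) \<in> F i"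
      unfolding F_def by (rule line_in_lines_over_div[OF q])
    with i have "line (unit_vec (\<phi> i / real q)) \<in> arrangement_lines C"
      unfolding lines by auto
    with orb[OF i(1)] i(2) show ?thesis by blast
  qed
  have "F 0 \<inter> F i = {}" "F (n + 1) \<inter> F i = {}" if "i \<in> {1..n}" for i
    using that disj[of 0 i] disj[of "n + 1" i] by auto
  then have inter: "mirrors G \<inter> \<Union>\<O> = {}"
    unfolding mirrors Un by blast
  have "?I = {0, n + 1} \<union> {1..n}" by auto
  then have union: "arrangement_lines C = mirrors G \<union> \<Union>\<O>"
    unfolding lines mirrors Un by (simp add: Un_assoc)
  have mult: "k = 1" if Lk: "(L, k) \<in> arrangement C" and L: "L \<in> \<Union>\<O>" for L k
  proof -
    obtain i s where i: "i \<in> ?I" and Li: "L = line (unit_vec ((\<phi> i + pi * real s) / real q))"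
      and k: "k = A_mult m mt n i"
      using Lk by (auto simp: C_def T_config_def angle_config_def arrangement_def)
    \<comment> \<open>The fibre that contains L determines the index and thereby the
      multiplicity.\<close>
    have "L \<in> F i"
      unfolding F_def Li line_in_lines_over_iff using q by (simp add: sin_npi2)
    moreover obtain i' where i': "i' \<in> {1..n}" "L \<in> F i'" using L unfolding Un by blast
    ultimately have "i = i'" using disj[of i i'] i by auto
    with i' k show ?thesis by (simp add: A_mult_def)
  qed
  have "card G = 4 * q" unfolding G_def using card_dihedral[of "2 * q"] q by simp
  with card orbits inter union mult have "let G = dihedral (2 * q) \<theta> in
       card G = 4 * q \<and> card \<O> = n div 2 \<and>
       (\<forall>B\<in>\<O>. \<exists>L\<in>arrangement_lines C. B = line_orbit G L) \<and>
       mirrors G \<inter> \<Union>\<O> = {} \<and>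
       arrangement_lines C = mirrors G \<union> \<Union>\<O> \<and>
       (\<forall>(L, k)\<in>arrangement C. L \<in> \<Union>\<O> \<longrightarrow> k = 1)"
    unfolding G_def[symmetric] Let_def by blast
  with conf BA show ?thesis unfolding C_def[symmetric] Let_def by blast
qed

end
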